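(* Let $\lambda\in\mathbb{C}^*$, $a\in\mathbb{C}$. For any nontrivial simple $W\in\mathcal{O}_{\mathfrak{W}}$, the subspace $$\mathcal{L}'(W,\lambda,a,1)=\bigoplus_{n\in\mathbb{Z}}\big((d_{-1}-a-n)W\big)\otimes t^n\subset\mathcal{L}(W,\lambda,a,1)$$ is a $\mathfrak{V}$-submodule which is isomorphic to $\mathcal{L}(W,\lambda,a,0)$, and the quotient satisfies $$\mathcal{L}(W,\lambda,a,1)/\mathcal{L}'(W,\lambda,a,1)\cong\mathcal{N}\big((\mathrm{Soc}_{\mathfrak{b}}W)_{(1)},a\big).$$
   Context: The Virasoro algebra $\mathfrak{V}$ has basis $\{d_n,z : n\in\mathbb{Z}\}$, $z$ central, $[d_n,d_m]=(m-n)d_{m+n}+\delta_{n,-m}\frac{n^3-n}{12}z$. $\mathfrak{W}=\mathrm{Der}(\mathbb{C}[t])$ has basis $\{d_i=t^{i+1}\frac{d}{dt} : i\ge-1\}$ with $[d_n,d_m]=(m-n)d_{m+n}$, and $\mathfrak{b}=\mathrm{span}\{d_i : i\ge0\}$. $\mathcal{O}_{\mathfrak{W}}$ (resp. $\mathcal{O}_{\mathfrak{b}}$) is the category of all $\mathfrak{W}$-modules (resp. $\mathfrak{b}$-modules) $M$ such that for every $w\in M$ there is a nonnegative integer $n$ (depending on $w$) with $d_iw=0$ for all $i\ge n$. A module $V$ over a Lie algebra $L$ is trivial if $LV=0$, nontrivial otherwise. For $W\in\mathcal{O}_{\mathfrak{W}}$, $\lambda\in\mathbb{C}^*$, $a,b\in\mathbb{C}$,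 $\mathcal{L}(W,\lambda,a,b)=W\otimes\mathbb{C}[t,t^{-1}]$ is the $\mathfrak{V}$-module with $z\cdot(w\otimes t^j)=0$ and $d_k\cdot(w\otimes t^j)=\big(((\lambda^ke^{kt}-1)\frac{d}{dt}+a+kb+j)w\big)\otimes t^{k+j}$ for $k,j\in\mathbb{Z}$, $w\in W$, where $\frac{d}{dt}$ acts as $d_{-1}$ and $e^{kt}\frac{d}{dt}$ acts as $\sum_{i\ge0}\frac{k^i}{i!}d_{i-1}$. $\mathrm{Soc}_{\mathfrak{b}}W$ is the sum of the minimal nonzero $\mathfrak{b}$-submodules of $W$. For a simple $\mathfrak{b}$-module $B$ and $b\in\mathbb{C}$, $B_{(b)}$ is the $\mathfrak{b}$-module on the same space with new action $d_0\cdot v=(d_0+b)v$ and $d_i\cdot v=d_iv$ for $i>0$. For $B\in\mathcal{O}_{\mathfrak{b}}$ and $a\in\mathbb{C}$, $\mathcal{N}(B,a)=B\otimes\mathbb{C}[t,t^{-1}]$ is the $\mathfrak{V}$-module with $z$ acting as $0$ and $d_m\cdot(v\otimes t^n)=\big((a+n)v+\sum_{i\ge0}\frac{m^{i+1}}{(i+1)!}d_iv\big)\otimes t^{n+m}$. *)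

theory Defs
  imports
    "HOL-Computational_Algebra.Polynomial"
    "HOL-Library.Poly_Mapping"
    "HOL-Algebra.Module"
    "HOL-Algebra.AbelCoset"
begin

definition complex_field :: "complex ring" where
  "complex_field = \<lparr>carrier = UNIV, mult = (*), one = 1, zero = 0, add = (+)\<rparr>"

text \<open>Both records extend the library record of modules. Its fields \<open>mult\<close> and \<open>one\<close>
  are inherited from rings and play no role for a module.\<close>

record 'l lie_algebra = "(complex, 'l) module" +
  bracket :: "'l \<Rightarrow> 'l \<Rightarrow> 'l"

record ('l, 'v) lie_module = "(complex, 'v) module" +
  act :: "'l \<Rightarrow> 'v \<Rightarrow> 'v"

definition lie_module :: "'l lie_algebra \<Rightarrow> ('l, 'v) lie_module \<Rightarrow> bool" where
  "lie_module L M \<longleftrightarrow>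
     module complex_field M \<and>
     (\<forall>x\<in>carrier L. \<forall>v\<in>carrier M. act M x v \<in> carrier M) \<and>
     (\<forall>x\<in>carrier L. \<forall>u\<in>carrier M. \<forall>v\<in>carrier M.
        act M x (u \<oplus>\<^bsub>M\<^esub> v) = act M x u \<oplus>\<^bsub>M\<^esub> act M x v) \<and>
     (\<forall>x\<in>carrier L. \<forall>c. \<forall>v\<in>carrier M. act M x (c \<odot>\<^bsub>M\<^esub> v) = c \<odot>\<^bsub>M\<^esub> act M x v) \<and>
     (\<forall>x\<in>carrier L. \<forall>y\<in>carrier L. \<forall>v\<in>carrier M.
        act M (x \<oplus>\<^bsub>L\<^esub> y) v = act M x v \<oplus>\<^bsub>M\<^esub> act M y v) \<and>
     (\<forall>c. \<forall>x\<in>carrier L. \<forall>v\<in>carrier M. act M (c \<odot>\<^bsub>L\<^esub> x) v = c \<odot>\<^bsub>M\<^esub> act M x v) \<and>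
     (\<forall>x\<in>carrier L. \<forall>y\<in>carrier L. \<forall>v\<in>carrier M.
        act M (bracket L x y) v = act M x (act M y v) \<ominus>\<^bsub>M\<^esub> act M y (act M x v))"

definition lie_submodule :: "'l lie_algebra \<Rightarrow> 'v set \<Rightarrow> ('l, 'v) lie_module \<Rightarrow> bool" where
  "lie_submodule L H M \<longleftrightarrow>
     submodule H complex_field M \<and> (\<forall>x\<in>carrier L. \<forall>v\<in>H. act M x v \<in> H)"

definition simple_lie_module :: "'l lie_algebra \<Rightarrow> ('l, 'v) lie_module \<Rightarrow> bool" where
  "simple_lie_module L M \<longleftrightarrow>
     carrier M \<noteq> {\<zero>\<^bsub>M\<^esub>} \<and>
     (\<forall>H. lie_submodule L H M \<longrightarrow> H = {\<zero>\<^bsub>M\<^esub>} \<or> H = carrier M)"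

definition trivial_lie_module :: "'l lie_algebra \<Rightarrow> ('l, 'v) lie_module \<Rightarrow> bool" where
  "trivial_lie_module L M \<longleftrightarrow> (\<forall>x\<in>carrier L. \<forall>v\<in>carrier M. act M x v = \<zero>\<^bsub>M\<^esub>)"

definition minimal_submodule :: "'l lie_algebra \<Rightarrow> 'v set \<Rightarrow> ('l, 'v) lie_module \<Rightarrow> bool" where
  "minimal_submodule L H M \<longleftrightarrow>
     lie_submodule L H M \<and> H \<noteq> {\<zero>\<^bsub>M\<^esub>} \<and>
     (\<forall>K. lie_submodule L K M \<and> K \<subseteq> H \<and> K \<noteq> {\<zero>\<^bsub>M\<^esub>} \<longrightarrow> K = H)"

definition socle :: "'l lie_algebra \<Rightarrow> ('l, 'v) lie_module \<Rightarrow> 'v set" where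
  "socle L M =
     {finsum M f F | F f. finite F \<and> (\<forall>H\<in>F. minimal_submodule L H M \<and> f H \<in> H)}"

definition lie_iso ::
  "'l lie_algebra \<Rightarrow> ('l, 'u) lie_module \<Rightarrow> ('l, 'v) lie_module \<Rightarrow> bool" where
  "lie_iso L M N \<longleftrightarrow> (\<exists>\<phi>.
     bij_betw \<phi> (carrier M) (carrier N) \<and>
     (\<forall>u\<in>carrier M. \<forall>v\<in>carrier M. \<phi> (u \<oplus>\<^bsub>M\<^esub> v) = \<phi> u \<oplus>\<^bsub>N\<^esub> \<phi> v) \<and>
     (\<forall>c. \<forall>v\<in>carrier M. \<phi> (c \<odot>\<^bsub>M\<^esub> v) = c \<odot>\<^bsub>N\<^esub> \<phi> v) \<and>
     (\<forall>x\<in>carrier L. \<forall>v\<in>carrier M. \<phi> (act M x v) = act N x (\<phi> v)))"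

text \<open>Operations on cosets are given by operations on representatives: when \<open>H\<close> is a
  submodule and \<open>X\<close> a coset of \<open>H\<close>, all members of each of the two unions are equal.\<close>

definition lie_quotient :: "('l, 'v) lie_module \<Rightarrow> 'v set \<Rightarrow> ('l, 'v set) lie_module" where
  "lie_quotient M H =
     \<lparr>carrier = a_rcosets\<^bsub>M\<^esub> H, mult = undefined, one = undefined,
      zero = H, add = (\<lambda>X Y. X <+>\<^bsub>M\<^esub> Y),
      smult = (\<lambda>c X. \<Union>v\<in>X. H +>\<^bsub>M\<^esub> (c \<odot>\<^bsub>M\<^esub> v)),
      act = (\<lambda>x X. \<Union>v\<in>X. H +>\<^bsub>M\<^esub> act M x v)\<rparr>"

definition type_module ::
  "(complex \<Rightarrow> 'v \<Rightarrow> 'v) \<Rightarrow> ('l \<Rightarrow> 'v \<Rightarrow> 'v) \<Rightarrow> ('l, 'v::ab_group_add) lie_module" where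
  "type_module s \<rho> =
     \<lparr>carrier = UNIV, mult = undefined, one = undefined, zero = 0, add = (+),
      smult = s, act = \<rho>\<rparr>"

text \<open>The polynomial \<open>f\<close> stands for the derivation \<open>f d/dt\<close>, so that
  \<open>d\<^sub>i = t\<^sup>i\<^sup>+\<^sup>1 d/dt\<close> is \<open>monom 1 (i + 1)\<close> for \<open>i \<ge> -1\<close>.\<close>

definition witt :: "complex poly lie_algebra" where
  "witt =
     \<lparr>carrier = UNIV, mult = undefined, one = undefined, zero = 0, add = (+),
      smult = Polynomial.smult, bracket = (\<lambda>f g. f * pderiv g - g * pderiv f)\<rparr>"

definition borel_subalgebra :: "complex poly lie_algebra" where
  "borel_subalgebra = witt\<lparr>carrier := {f. coeff f 0 = 0}\<rparr>"

text \<open>The pair \<open>(x, c)\<close> stands for \<open>(\<Sum>n. x\<^sub>n d\<^sub>n) + c z\<close>.\<close>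

type_synonym vir = "(int \<Rightarrow>\<^sub>0 complex) \<times> complex"

definition vir_bracket :: "vir \<Rightarrow> vir \<Rightarrow> vir" where
  "vir_bracket p q =
     (\<Sum>n\<in>Poly_Mapping.keys (fst p). \<Sum>m\<in>Poly_Mapping.keys (fst q).
        Poly_Mapping.single (m + n)
          (Poly_Mapping.lookup (fst p) n * Poly_Mapping.lookup (fst q) m * of_int (m - n)),
      \<Sum>n\<in>Poly_Mapping.keys (fst p). \<Sum>m\<in>Poly_Mapping.keys (fst q).
        (if n = - m
         then Poly_Mapping.lookup (fst p) n * Poly_Mapping.lookup (fst q) m * (of_int (n ^ 3 - n) / 12) else 0))"

definition virasoro :: "vir lie_algebra" where
  "virasoro =
     \<lparr>carrier = UNIV, mult = undefined, one = undefined, zero = (0, 0),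
      add = (\<lambda>p q. (fst p + fst q, snd p + snd q)),
      smult = (\<lambda>c p. (Poly_Mapping.map ((*) c) (fst p), c * snd p)),
      bracket = vir_bracket\<rparr>"

lemma witt_bracket_basis:
  assumes "n \<ge> -1" "m \<ge> -1" "m + n \<ge> -1"
  shows "bracket witt (monom 1 (nat (n + 1))) (monom 1 (nat (m + 1))) =
           Polynomial.smult (of_int (m - n)) (monom 1 (nat (m + n + 1)))"
proof -
  obtain i j :: nat where ij: "n = int i - 1" "m = int j - 1"
    using assms(1,2) by (metis add_diff_cancel_right' nonneg_int_cases
        add.commute diff_ge_0_iff_ge diff_minus_eq_add)
  show ?thesis
    using assms(3) unfolding ij witt_def
    by (cases i; cases j)
      (auto simp: pderiv_monom mult_monom smult_monom diff_monom minus_monom monom_eq_iff'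
        nat_add_distrib algebra_simps)
qed

lemma vir_bracket_basis:
  "bracket virasoro (Poly_Mapping.single n 1, c) (Poly_Mapping.single m 1, e) =
     (Poly_Mapping.single (m + n) (of_int (m - n)),
      if n = - m then of_int (n ^ 3 - n) / 12 else 0)"
  by (simp add: virasoro_def vir_bracket_def)

definition in_category_O :: "(complex poly, 'w) lie_module \<Rightarrow> bool" where
  "in_category_O W \<longleftrightarrow>
     lie_module witt W \<and>
     (\<forall>w\<in>carrier W. \<exists>n::nat. \<forall>i\<ge>n. act W (monom 1 (i + 1)) w = \<zero>\<^bsub>W\<^esub>)"

text \<open>The element \<open>\<Sum>n. v\<^sub>n \<otimes> t\<^sup>n\<close> is represented by the finitely supported function
  \<open>n \<mapsto> v\<^sub>n\<close>. If \<open>d\<^sub>k\<close> sends \<open>v \<otimes> t\<^sup>j\<close> to \<open>(D k j v) \<otimes> t\<^sup>k\<^sup>+\<^sup>j\<close> and \<open>z\<close> acts as \<open>0\<close>, then the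
  coefficient at \<open>t\<^sup>n\<close> of \<open>((\<Sum>k. x\<^sub>k d\<^sub>k) + c z) f\<close> is \<open>\<Sum>k. x\<^sub>k D k (n - k) f\<^sub>n\<^sub>-\<^sub>k\<close>.\<close>

definition laurent_module ::
  "('l, 'v) lie_module \<Rightarrow> (int \<Rightarrow> int \<Rightarrow> 'v \<Rightarrow> 'v) \<Rightarrow> (vir, int \<Rightarrow> 'v) lie_module" where
  "laurent_module M D =
     \<lparr>carrier = {f. (\<forall>n. f n \<in> carrier M) \<and> finite {n. f n \<noteq> \<zero>\<^bsub>M\<^esub>}},
      mult = undefined, one = undefined,
      zero = (\<lambda>n. \<zero>\<^bsub>M\<^esub>), add = (\<lambda>f g n. f n \<oplus>\<^bsub>M\<^esub> g n),
      smult = (\<lambda>c f n. c \<odot>\<^bsub>M\<^esub> f n),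
      act = (\<lambda>p f n. \<Oplus>\<^bsub>M\<^esub>k\<in>Poly_Mapping.keys (fst p). Poly_Mapping.lookup (fst p) k \<odot>\<^bsub>M\<^esub> D k (n - k) (f (n - k)))\<rparr>"

definition tensor :: "('l, 'v) lie_module \<Rightarrow> 'v \<Rightarrow> int \<Rightarrow> (int \<Rightarrow> 'v)" where
  "tensor M v j = (\<lambda>n. if n = j then v else \<zero>\<^bsub>M\<^esub>)"

lemma laurent_module_act_tensor:
  assumes M: "module complex_field M"
    and v: "D k j v \<in> carrier M" and D0: "\<And>j. D k j \<zero>\<^bsub>M\<^esub> = \<zero>\<^bsub>M\<^esub>"
  shows "act (laurent_module M D) (Poly_Mapping.single k 1, c) (tensor M v j) =
           tensor M (D k j v) (k + j)"
proof
  fix n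
  interpret module complex_field M by (fact M)
  have one: "1 \<odot>\<^bsub>M\<^esub> u = u" if "u \<in> carrier M" for u
    using smult_one[OF that] by (simp add: complex_field_def)
  show "act (laurent_module M D) (Poly_Mapping.single k 1, c) (tensor M v j) n =
          tensor M (D k j v) (k + j) n"
    using v by (auto simp: laurent_module_def tensor_def D0 one M.finsum_insert)
qed

text \<open>Only meaningful for a sequence with finitely many nonzero terms.\<close>

definition finsupp_sum :: "('l, 'v) lie_module \<Rightarrow> (nat \<Rightarrow> 'v) \<Rightarrow> 'v" where
  "finsupp_sum M g = finsum M g {i. g i \<noteq> \<zero>\<^bsub>M\<^esub>}"

text \<open>The action of \<open>e\<^sup>k\<^sup>t d/dt\<close>; note \<open>d\<^sub>i\<^sub>-\<^sub>1 = monom 1 i\<close>.\<close>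

definition exp_act :: "(complex poly, 'w) lie_module \<Rightarrow> int \<Rightarrow> 'w \<Rightarrow> 'w" where
  "exp_act W k w =
     finsupp_sum W (\<lambda>i. (of_int k ^ i / fact i) \<odot>\<^bsub>W\<^esub> act W (monom 1 i) w)"

definition L_module ::
  "(complex poly, 'w) lie_module \<Rightarrow> complex \<Rightarrow> complex \<Rightarrow> complex \<Rightarrow>
     (vir, int \<Rightarrow> 'w) lie_module" where
  "L_module W l a b = laurent_module W (\<lambda>k j w.
     (((l powi k) \<odot>\<^bsub>W\<^esub> exp_act W k w) \<ominus>\<^bsub>W\<^esub> act W (monom 1 0) w)
       \<oplus>\<^bsub>W\<^esub> (a + of_int k * b + of_int j) \<odot>\<^bsub>W\<^esub> w)"

definition L_prime ::
  "(complex poly, 'w) lie_module \<Rightarrow> complex \<Rightarrow> complex \<Rightarrow> (int \<Rightarrow> 'w) set" where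
  "L_prime W l a =
     {f \<in> carrier (L_module W l a 1).
        \<forall>n. f n \<in> (\<lambda>w. act W (monom 1 0) w \<ominus>\<^bsub>W\<^esub> (a + of_int n) \<odot>\<^bsub>W\<^esub> w) ` carrier W}"

text \<open>The coefficient of \<open>d\<^sub>0 = t d/dt\<close> in \<open>x\<close> is \<open>coeff x 1\<close>.\<close>

definition twist ::
  "(complex poly, 'v) lie_module \<Rightarrow> complex \<Rightarrow> (complex poly, 'v) lie_module" where
  "twist B b = B\<lparr>act := (\<lambda>x v. act B x v \<oplus>\<^bsub>B\<^esub> (b * coeff x 1) \<odot>\<^bsub>B\<^esub> v)\<rparr>"

definition N_module ::
  "(complex poly, 'v) lie_module \<Rightarrow> complex \<Rightarrow> (vir, int \<Rightarrow> 'v) lie_module" where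
  "N_module B a = laurent_module B (\<lambda>m n v.
     (a + of_int n) \<odot>\<^bsub>B\<^esub> v \<oplus>\<^bsub>B\<^esub>
       finsupp_sum B (\<lambda>i. (of_int m ^ (i + 1) / fact (i + 1)) \<odot>\<^bsub>B\<^esub> act B (monom 1 (i + 1)) v))"

end

theory Submission
  imports Defs
begin

text \<open>Write \<open>D = d/dt\<close> and \<open>\<bb>\<close> for the span of all \<open>t\<^sup>i d/dt\<close> with \<open>i > 0\<close>. Let \<open>W\<^sub>r\<close> be the space of
  vectors killed by all \<open>t\<^sup>i d/dt\<close> with \<open>i > r\<close>; a vector of \<open>W\<^sub>r\<close> has exact level \<open>r\<close> if
  \<open>t\<^sup>r d/dt\<close> does not kill it. Every \<open>W\<^sub>r\<close> is a submodule for \<open>\<bb>\<close>, these spaces exhaust \<open>W\<close>, and every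
  nonzero vector has an exact level since \<open>W\<close> has no invariants (\<open>exact_level\<close>). From
  \<open>[t\<^sup>i d/dt, D] = - i t\<^sup>i\<^sup>-\<^sup>1 d/dt\<close> one sees that \<open>D - c\<close> raises the exact level of a nonzero vector by one,
  for every scalar \<open>c\<close> (\<open>e_shift_top\<close>). Let \<open>B\<close> be the lowest nonzero \<open>W\<^sub>r\<close>. Then \<open>D - c\<close> is injective and
  its image meets \<open>B\<close> only in zero (\<open>shift_notin_base\<close>). Conversely, any nonzero \<open>\<bb>\<close>-submodule \<open>H\<close>
  generates \<open>W\<close> under \<open>D\<close>, so that \<open>W = H + (D - c) W\<close> (\<open>shift_decomposition\<close>). In particular
  \<open>W = B \<oplus> (D - c) W\<close>.

  To see that \<open>B\<close> is the socle, note first that its level is positive, since otherwise \<open>D W\<close> would be a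
  proper nonzero submodule (\<open>depth_pos\<close>). Given a vector of exact level \<open>m\<close> in a nonzero
  \<open>\<bb>\<close>-submodule \<open>H\<close>, the operator \<open>t\<^sup>m d/dt\<close> therefore belongs to \<open>\<bb>\<close>, and it sends the vector to a
  nonzero element of \<open>B\<close> (\<open>e_top_in_base\<close>). So \<open>H \<inter> B\<close> is nonzero, and decomposing the elements of
  \<open>B\<close> along \<open>W = (H \<inter> B) + D W\<close> gives \<open>B \<subseteq> H\<close>. Thus \<open>B\<close> is the unique minimal
  \<open>\<bb>\<close>-submodule (\<open>base_subset\<close>, \<open>socle_eq_base\<close>).

  With this structure both claims become computations with operators, degree by degree. Since
  \<open>[D, e\<^sup>k\<^sup>t D] = k e\<^sup>k\<^sup>t D\<close>, the operators \<open>D - a - n\<close> intertwine the actions for \<open>b = 0\<close> and \<open>b = 1\<close>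
  (\<open>\<theta>_L_op\<close>). They are injective, so they identify \<open>\<L>(W, l, a, 0)\<close> with its image \<open>\<L>'(W, l, a, 1)\<close>. In the
  quotient, degree \<open>n\<close> is \<open>W / (D - a - n) W\<close>, which is \<open>B\<close>, and \<open>D\<close> acts there as \<open>a + n\<close>. The operator of
  \<open>d\<^sub>k\<close> therefore becomes \<open>l\<^sup>k ((a + n) + (e\<^sup>k\<^sup>t D - D))\<close> with \<open>n\<close> the target degree. The factor
  \<open>l\<^sup>k\<close> disappears after rescaling degree \<open>n\<close> by \<open>l\<^sup>-\<^sup>n\<close>, and counting from the source degree
  \<open>n - k\<close> leaves the extra scalar \<open>k\<close>, which is the twist by one (\<open>N_op_eq\<close>, \<open>proj_L_op\<close>). The
  projections onto \<open>B\<close> thus form an epimorphism with kernel \<open>\<L>'(W, l, a, 1)\<close>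
  (\<open>L_quotient_epimorphism\<close>). This proves that the kernel is a submodule and, by the first
  isomorphism theorem, determines the quotient.\<close>

section \<open>Homomorphisms and the first isomorphism theorem\<close>

definition lie_hom ::
  "'l lie_algebra \<Rightarrow> ('l, 'u) lie_module \<Rightarrow> ('l, 'v) lie_module \<Rightarrow> ('u \<Rightarrow> 'v) \<Rightarrow> bool" where
  "lie_hom L M N \<phi> \<longleftrightarrow>
     \<phi> \<in> carrier M \<rightarrow> carrier N \<and>
     (\<forall>u\<in>carrier M. \<forall>v\<in>carrier M. \<phi> (u \<oplus>\<^bsub>M\<^esub> v) = \<phi> u \<oplus>\<^bsub>N\<^esub> \<phi> v) \<and>
     (\<forall>c. \<forall>v\<in>carrier M. \<phi> (c \<odot>\<^bsub>M\<^esub> v) = c \<odot>\<^bsub>N\<^esub> \<phi> v) \<and>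
     (\<forall>x\<in>carrier L. \<forall>v\<in>carrier M. \<phi> (act M x v) = act N x (\<phi> v))"

lemma lie_homD:
  assumes "lie_hom L M N \<phi>"
  shows "v \<in> carrier M \<Longrightarrow> \<phi> v \<in> carrier N"
    and "u \<in> carrier M \<Longrightarrow> v \<in> carrier M \<Longrightarrow> \<phi> (u \<oplus>\<^bsub>M\<^esub> v) = \<phi> u \<oplus>\<^bsub>N\<^esub> \<phi> v"
    and "v \<in> carrier M \<Longrightarrow> \<phi> (c \<odot>\<^bsub>M\<^esub> v) = c \<odot>\<^bsub>N\<^esub> \<phi> v"
    and "x \<in> carrier L \<Longrightarrow> v \<in> carrier M \<Longrightarrow> \<phi> (act M x v) = act N x (\<phi> v)"
  using assms by (auto simp: lie_hom_def)

lemma carrier_complex_field [simp]: "carrier complex_field = UNIV"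
  by (simp add: complex_field_def)

lemma cring_complex_field: "cring complex_field"
proof (rule cringI)
  show "abelian_group complex_field"
    by (rule abelian_groupI)
      (auto simp: complex_field_def algebra_simps intro: exI[of _ "- x" for x])
  show "comm_monoid complex_field"
    by (rule comm_monoidI) (auto simp: complex_field_def algebra_simps)
qed (auto simp: complex_field_def algebra_simps)

text \<open>Isomorphism as encoded by \<^const>\<open>lie_iso\<close> is directed, and the natural map between the two
  sides may point the other way, as it does for \<^const>\<open>L_prime\<close>. Closure of \<open>N\<close> is what lets
  the inverse be computed on sums, multiples and images under the action.\<close>

lemma lie_iso_inverse:
  assumes hom: "lie_hom L N M \<phi>" and bij: "bij_betw \<phi> (carrier N) (carrier M)"
    and closed: "\<And>u v. u \<in> carrier N \<Longrightarrow> v \<in> carrier N \<Longrightarrow> u \<oplus>\<^bsub>N\<^esub> v \<in> carrier N"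
      "\<And>c v. v \<in> carrier N \<Longrightarrow> c \<odot>\<^bsub>N\<^esub> v \<in> carrier N"
      "\<And>x v. x \<in> carrier L \<Longrightarrow> v \<in> carrier N \<Longrightarrow> act N x v \<in> carrier N"
  shows "lie_iso L M N"
proof -
  define \<psi> where "\<psi> = inv_into (carrier N) \<phi>"
  have \<psi>\<phi>: "\<psi> (\<phi> v) = v" if "v \<in> carrier N" for v
    unfolding \<psi>_def using bij that by (rule bij_betw_inv_into_left)
  have surj: "\<exists>u'\<in>carrier N. u = \<phi> u'" if "u \<in> carrier M" for u
    using bij that by (auto simp: bij_betw_def)
  show ?thesis
    unfolding lie_iso_def
  proof (intro exI[of _ \<psi>] conjI ballI allI)
    show "bij_betw \<psi> (carrier M) (carrier N)"
      unfolding \<psi>_def using bij by (rule bij_betw_inv_into)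
  next
    fix u v
    assume "u \<in> carrier M" "v \<in> carrier M"
    then show "\<psi> (u \<oplus>\<^bsub>M\<^esub> v) = \<psi> u \<oplus>\<^bsub>N\<^esub> \<psi> v"
      using surj closed lie_homD(2)[OF hom] \<psi>\<phi> by metis
  next
    fix c v
    assume "v \<in> carrier M"
    then show "\<psi> (c \<odot>\<^bsub>M\<^esub> v) = c \<odot>\<^bsub>N\<^esub> \<psi> v"
      using surj closed lie_homD(3)[OF hom] \<psi>\<phi> by metis
  next
    fix x v
    assume "x \<in> carrier L" "v \<in> carrier M"
    then show "\<psi> (act M x v) = act N x (\<psi> v)"
      using surj closed lie_homD(4)[OF hom] \<psi>\<phi> by metis
  qed
qed

text \<open>Linearity of \<open>\<phi>\<close> and compatibility with each single operator suffice to make the quotient by the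
  kernel isomorphic to \<open>N\<close>.\<close>

locale lie_epimorphism =
  M?: module complex_field M + N?: module complex_field N
  for L :: "'l lie_algebra" and M :: "('l, 'u) lie_module" and N :: "('l, 'v) lie_module" +
  fixes \<phi> :: "'u \<Rightarrow> 'v"
  assumes hom: "lie_hom L M N \<phi>"
    and surj: "\<phi> ` carrier M = carrier N"
    and act_closed: "x \<in> carrier L \<Longrightarrow> v \<in> carrier M \<Longrightarrow> act M x v \<in> carrier M"
    and act_zero: "x \<in> carrier L \<Longrightarrow> act N x \<zero>\<^bsub>N\<^esub> = \<zero>\<^bsub>N\<^esub>"
begin

definition ker :: "'u set" where
  "ker = {v \<in> carrier M. \<phi> v = \<zero>\<^bsub>N\<^esub>}"

lemma hom_closed [simp]: "v \<in> carrier M \<Longrightarrow> \<phi> v \<in> carrier N"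
  and hom_add: "u \<in> carrier M \<Longrightarrow> v \<in> carrier M \<Longrightarrow> \<phi> (u \<oplus>\<^bsub>M\<^esub> v) = \<phi> u \<oplus>\<^bsub>N\<^esub> \<phi> v"
  and hom_smult: "v \<in> carrier M \<Longrightarrow> \<phi> (c \<odot>\<^bsub>M\<^esub> v) = c \<odot>\<^bsub>N\<^esub> \<phi> v"
  and hom_act: "x \<in> carrier L \<Longrightarrow> v \<in> carrier M \<Longrightarrow> \<phi> (act M x v) = act N x (\<phi> v)"
  using lie_homD[OF hom] by blast+

lemma hom_zero: "\<phi> \<zero>\<^bsub>M\<^esub> = \<zero>\<^bsub>N\<^esub>"
  using hom_add[of "\<zero>\<^bsub>M\<^esub>" "\<zero>\<^bsub>M\<^esub>"] by (metis M.M.zero_closed M.M.r_zero N.M.add.r_cancel_one' hom_closed)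

lemma hom_minus:
  assumes "v \<in> carrier M"
  shows "\<phi> (\<ominus>\<^bsub>M\<^esub> v) = \<ominus>\<^bsub>N\<^esub> \<phi> v"
proof -
  have "\<phi> (\<ominus>\<^bsub>M\<^esub> v) \<oplus>\<^bsub>N\<^esub> \<phi> v = \<zero>\<^bsub>N\<^esub>"
    using hom_add[of "\<ominus>\<^bsub>M\<^esub> v" v] assms by (simp add: M.M.l_neg hom_zero)
  then show ?thesis
    using assms N.M.minus_equality by (metis M.M.a_inv_closed hom_closed)
qed

lemma lie_submodule_ker: "lie_submodule L ker M"
  unfolding lie_submodule_def
proof (intro conjI ballI)
  show "submodule ker complex_field M"
    by (rule M.submoduleI) (auto simp: ker_def hom_zero hom_minus hom_add hom_smult)
next
  fix x v
  assume "x \<in> carrier L" "v \<in> ker"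
  then show "act M x v \<in> ker"
    by (simp add: ker_def act_closed hom_act act_zero)
qed

text \<open>Describing cosets as fibres of \<open>\<phi>\<close> makes the operations of \<^const>\<open>lie_quotient\<close>, which are unions
  over representatives, visibly independent of the representative.\<close>

lemma coset_eq_fibre:
  assumes v: "v \<in> carrier M"
  shows "ker +>\<^bsub>M\<^esub> v = {u \<in> carrier M. \<phi> u = \<phi> v}"
proof
  show "ker +>\<^bsub>M\<^esub> v \<subseteq> {u \<in> carrier M. \<phi> u = \<phi> v}"
    using v by (auto simp: a_r_coset_def' ker_def hom_add)
  show "{u \<in> carrier M. \<phi> u = \<phi> v} \<subseteq> ker +>\<^bsub>M\<^esub> v"
  proof
    fix u
    assume "u \<in> {u \<in> carrier M. \<phi> u = \<phi> v}"
    then have u: "u \<in> carrier M" "\<phi> u = \<phi> v" by auto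
    then have "u \<oplus>\<^bsub>M\<^esub> \<ominus>\<^bsub>M\<^esub> v \<in> ker"
      using v by (simp add: ker_def hom_add hom_minus N.M.r_neg)
    moreover have "u = (u \<oplus>\<^bsub>M\<^esub> \<ominus>\<^bsub>M\<^esub> v) \<oplus>\<^bsub>M\<^esub> v"
      using u v by (simp add: M.M.a_assoc M.M.l_neg)
    ultimately show "u \<in> ker +>\<^bsub>M\<^esub> v"
      by (auto simp: a_r_coset_def')
  qed
qed

lemma set_add_cosets:
  assumes u: "u \<in> carrier M" and v: "v \<in> carrier M"
  shows "(ker +>\<^bsub>M\<^esub> u) <+>\<^bsub>M\<^esub> (ker +>\<^bsub>M\<^esub> v) = ker +>\<^bsub>M\<^esub> (u \<oplus>\<^bsub>M\<^esub> v)"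
proof -
  have split: "\<exists>x. x \<in> carrier M \<and> \<phi> x = \<phi> u \<and> (\<exists>y. y \<in> carrier M \<and> \<phi> y = \<phi> v \<and> z = x \<oplus>\<^bsub>M\<^esub> y)"
    if z: "z \<in> carrier M" "\<phi> z = \<phi> u \<oplus>\<^bsub>N\<^esub> \<phi> v" for z
  proof -
    have "\<phi> (\<ominus>\<^bsub>M\<^esub> u \<oplus>\<^bsub>M\<^esub> z) = \<phi> v"
      using z u v by (simp add: hom_add hom_minus N.M.r_neg1)
    moreover have "z = u \<oplus>\<^bsub>M\<^esub> (\<ominus>\<^bsub>M\<^esub> u \<oplus>\<^bsub>M\<^esub> z)"
      using z u by (simp add: M.M.r_neg2)
    ultimately show ?thesis
      using z u by (intro exI[of _ u] exI[of _ "\<ominus>\<^bsub>M\<^esub> u \<oplus>\<^bsub>M\<^esub> z"] conjI) simp_all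
  qed
  show ?thesis
  proof (intro equalityI subsetI)
    fix z
    assume "z \<in> (ker +>\<^bsub>M\<^esub> u) <+>\<^bsub>M\<^esub> (ker +>\<^bsub>M\<^esub> v)"
    then show "z \<in> ker +>\<^bsub>M\<^esub> (u \<oplus>\<^bsub>M\<^esub> v)"
      using u v by (auto simp: coset_eq_fibre set_add_def' hom_add)
  next
    fix z
    assume "z \<in> ker +>\<^bsub>M\<^esub> (u \<oplus>\<^bsub>M\<^esub> v)"
    then have "z \<in> carrier M" "\<phi> z = \<phi> u \<oplus>\<^bsub>N\<^esub> \<phi> v"
      using u v by (simp_all add: coset_eq_fibre hom_add)
    then obtain x y where "x \<in> carrier M" "\<phi> x = \<phi> u" "y \<in> carrier M" "\<phi> y = \<phi> v"
      "z = x \<oplus>\<^bsub>M\<^esub> y"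
      using split by blast
    then show "z \<in> (ker +>\<^bsub>M\<^esub> u) <+>\<^bsub>M\<^esub> (ker +>\<^bsub>M\<^esub> v)"
      using u v by (auto simp: coset_eq_fibre set_add_def')
  qed
qed

theorem first_isomorphism: "lie_iso L (lie_quotient M ker) N"
proof -
  define \<psi> where "\<psi> X = \<phi> (SOME v. v \<in> X)" for X
  let ?Q = "lie_quotient M ker"
  have \<psi>: "\<psi> (ker +>\<^bsub>M\<^esub> v) = \<phi> v" if "v \<in> carrier M" for v
  proof -
    have "v \<in> ker +>\<^bsub>M\<^esub> v"
      using that by (simp add: coset_eq_fibre)
    then have "(SOME u. u \<in> ker +>\<^bsub>M\<^esub> v) \<in> ker +>\<^bsub>M\<^esub> v"
      by (rule someI)
    then show ?thesis
      using that by (simp add: \<psi>_def coset_eq_fibre)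
  qed
  have carrier: "carrier ?Q = (\<lambda>v. ker +>\<^bsub>M\<^esub> v) ` carrier M"
    by (auto simp: lie_quotient_def A_RCOSETS_def')
  have smult: "c \<odot>\<^bsub>?Q\<^esub> (ker +>\<^bsub>M\<^esub> v) = ker +>\<^bsub>M\<^esub> (c \<odot>\<^bsub>M\<^esub> v)" if "v \<in> carrier M" for c v
    using that by (auto simp: lie_quotient_def coset_eq_fibre hom_smult)
  have act: "act ?Q x (ker +>\<^bsub>M\<^esub> v) = ker +>\<^bsub>M\<^esub> act M x v"
    if "x \<in> carrier L" "v \<in> carrier M" for x v
    using that by (auto simp: lie_quotient_def coset_eq_fibre hom_act act_closed)
  have add: "(ker +>\<^bsub>M\<^esub> u) \<oplus>\<^bsub>?Q\<^esub> (ker +>\<^bsub>M\<^esub> v) = ker +>\<^bsub>M\<^esub> (u \<oplus>\<^bsub>M\<^esub> v)"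
    if "u \<in> carrier M" "v \<in> carrier M" for u v
    using that by (simp add: lie_quotient_def set_add_cosets)
  have "inj_on \<psi> (carrier ?Q)"
  proof (rule inj_onI)
    fix X Y
    assume "X \<in> carrier ?Q" "Y \<in> carrier ?Q" and eq: "\<psi> X = \<psi> Y"
    then obtain u v where uv: "u \<in> carrier M" "v \<in> carrier M"
      and "X = ker +>\<^bsub>M\<^esub> u" "Y = ker +>\<^bsub>M\<^esub> v"
      unfolding carrier by blast
    then show "X = Y"
      using eq by (simp only: \<psi>) (simp only: coset_eq_fibre)
  qed
  moreover have "\<psi> ` carrier ?Q = carrier N"
    unfolding surj[symmetric] carrier image_image using \<psi> by (rule image_cong[OF refl])
  ultimately have "bij_betw \<psi> (carrier ?Q) (carrier N)"
    by (rule bij_betw_imageI)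
  then show ?thesis
    unfolding lie_iso_def
    by (intro exI[of _ \<psi>])
      (auto simp: carrier add smult act \<psi> hom_add hom_smult hom_act act_closed)
qed

end

section \<open>Laurent modules over subspaces of a complex vector space\<close>

locale complex_vector_space = vector_space s
  for s :: "complex \<Rightarrow> 'w::ab_group_add \<Rightarrow> 'w"
begin

text \<open>All coefficient modules below share the operations of one vector space and differ only in
  their carrier and their action. For them the algebraic-record operations (\<open>finsum\<close>, difference,
  finitely supported sums) reduce to the ordinary ones.\<close>

definition realises :: "('l, 'w) lie_module \<Rightarrow> 'w set \<Rightarrow> bool" where
  "realises M B \<longleftrightarrow> subspace B \<and> carrier M = B \<and> add M = (+) \<and> zero M = 0 \<and> smult M = s"

lemma realises_simps:
  assumes "realises M B"
  shows "carrier M = B" "add M = (+)" "zero M = 0" "smult M = s" "subspace B"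
  using assms by (auto simp: realises_def)

lemma realises_abelian_group:
  assumes "realises M B"
  shows "abelian_group M"
proof (rule abelian_groupI)
  fix x
  assume "x \<in> carrier M"
  then show "\<exists>y\<in>carrier M. y \<oplus>\<^bsub>M\<^esub> x = \<zero>\<^bsub>M\<^esub>"
    using subspace_neg[OF realises_simps(5)[OF assms], of x]
    by (intro bexI[of _ "- x"]) (simp_all add: realises_simps[OF assms])
qed (use subspace_add[OF realises_simps(5)[OF assms]] subspace_0[OF realises_simps(5)[OF assms]]
    in \<open>auto simp: realises_simps[OF assms] algebra_simps\<close>)

lemma realises_finsum:
  assumes "realises M B" "\<And>i. i \<in> A \<Longrightarrow> g i \<in> B"
  shows "finsum M g A = sum g A"
proof -
  interpret abelian_group M
    by (rule realises_abelian_group[OF assms(1)])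
  show ?thesis
    using assms(2)
  proof (induction A rule: infinite_finite_induct)
    case (insert i A)
    then show ?case
      using finsum_insert[of A i g] by (simp add: realises_simps[OF assms(1)] Pi_def)
  qed (simp_all add: realises_simps[OF assms(1)] finsum_infinite)
qed

lemma realises_minus:
  assumes M: "realises M B" "u \<in> B" "v \<in> B"
  shows "u \<ominus>\<^bsub>M\<^esub> v = u - v"
proof -
  interpret abelian_group M
    by (rule realises_abelian_group[OF assms(1)])
  have "- v \<in> B"
    using subspace_neg[OF realises_simps(5)[OF M(1)]] M(3) by blast
  then have "\<ominus>\<^bsub>M\<^esub> v = - v"
    using minus_equality[of "- v" v] M(3) by (simp add: realises_simps[OF M(1)])
  then show ?thesis
    by (simp add: a_minus_def realises_simps[OF M(1)])
qed

lemma realises_finsupp_sum: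
  assumes "realises M B" "\<And>i. g i \<in> B" "\<And>i. i \<ge> n \<Longrightarrow> g i = 0"
  shows "finsupp_sum M g = (\<Sum>i<n. g i)"
proof -
  have "finsupp_sum M g = sum g {i. g i \<noteq> 0}"
    unfolding finsupp_sum_def by (simp add: realises_finsum[OF assms(1)] assms(2) realises_simps[OF assms(1)])
  also have "\<dots> = (\<Sum>i<n. g i)"
    by (rule sum.mono_neutral_left) (use assms(3) in \<open>auto simp: not_less[symmetric]\<close>)
  finally show ?thesis .
qed

lemma realises_module:
  assumes M: "realises M B"
  shows "module complex_field M"
  using M by (intro moduleI cring_complex_field realises_abelian_group[OF M])
    (auto simp: realises_simps[OF M] complex_field_def scale_left_distrib scale_right_distrib
      subspace_scale[OF realises_simps(5)[OF M]])

lemma realises_submodule_iff: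
  assumes M: "realises M UNIV"
  shows "submodule H complex_field M \<longleftrightarrow> subspace H"
proof -
  interpret M: module complex_field M
    by (rule realises_module[OF M])
  show ?thesis
  proof
    assume H: "submodule H complex_field M"
    then obtain v where v: "v \<in> H"
      using M.submoduleE(2) by blast
    have scale: "s c u \<in> H" if "u \<in> H" for c u
      using M.submoduleE(4)[OF H, of c u] that by (simp add: realises_simps[OF M])
    show "subspace H"
      using M.submoduleE(5)[OF H] scale scale[OF v, of 0]
      by (intro subspaceI) (simp_all add: realises_simps[OF M])
  next
    assume H: "subspace H"
    have "\<ominus>\<^bsub>M\<^esub> v = - v" for v
      using M.minus_equality[of "- v" v] by (simp add: realises_simps[OF M])
    then show "submodule H complex_field M"
      using H by (intro M.submoduleI)
        (auto simp: realises_simps[OF M] subspace_0 subspace_add subspace_scale subspace_neg)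
  qed
qed

lemma laurent_carrier:
  assumes "realises M B"
  shows "f \<in> carrier (laurent_module M D) \<longleftrightarrow> (\<forall>n. f n \<in> B) \<and> finite {n. f n \<noteq> 0}"
  by (simp add: laurent_module_def realises_simps[OF assms])

lemma laurent_add: "realises M B \<Longrightarrow> add (laurent_module M D) = (\<lambda>f g n. f n + g n)"
  and laurent_smult: "realises M B \<Longrightarrow> smult (laurent_module M D) = (\<lambda>c f n. s c (f n))"
  and laurent_zero: "realises M B \<Longrightarrow> zero (laurent_module M D) = (\<lambda>n. 0)"
  by (simp_all add: laurent_module_def realises_simps)

lemma finite_support_add:
  fixes f g :: "int \<Rightarrow> 'w"
  assumes "finite {n. f n \<noteq> 0}" "finite {n. g n \<noteq> 0}"
  shows "finite {n. f n + g n \<noteq> 0}"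
  by (rule finite_subset[OF _ finite_UnI[OF assms]]) auto

lemma finite_support_map:
  fixes f :: "int \<Rightarrow> 'w"
  assumes "finite {n. f n \<noteq> 0}" "\<And>n. T n 0 = (0::'w)"
  shows "finite {n. T n (f n) \<noteq> 0}"
  by (rule finite_subset[OF _ assms(1)]) (auto simp: assms(2))

lemma laurent_module_module:
  assumes M: "realises M B"
  shows "module complex_field (laurent_module M D)"
proof -
  note B = realises_simps(5)[OF M]
  have scale: "finite {n. s c (f n) \<noteq> 0}" if "finite {n. f n \<noteq> 0}" for c and f :: "int \<Rightarrow> 'w"
    using that finite_support_map[of f "\<lambda>n. s c"] by simp
  note simps = laurent_carrier[OF M] laurent_add[OF M] laurent_smult[OF M] laurent_zero[OF M]
  show ?thesis
  proof (intro moduleI cring_complex_field abelian_groupI)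
    fix f
    assume "f \<in> carrier (laurent_module M D)"
    then show "\<exists>g\<in>carrier (laurent_module M D).
        g \<oplus>\<^bsub>laurent_module M D\<^esub> f = \<zero>\<^bsub>laurent_module M D\<^esub>"
      by (intro bexI[of _ "\<lambda>n. - f n"]) (auto simp: simps subspace_neg[OF B])
  qed (auto simp: simps complex_field_def finite_support_add scale scale_left_distrib
      scale_right_distrib subspace_0[OF B] subspace_add[OF B] subspace_scale[OF B] algebra_simps)
qed

lemma laurent_act:
  assumes M: "realises M B" and f: "\<And>n. f n \<in> B" and D: "\<And>k j v. v \<in> B \<Longrightarrow> D k j v \<in> B"
  shows "act (laurent_module M D) p f n =
    (\<Sum>k\<in>Poly_Mapping.keys (fst p). s (Poly_Mapping.lookup (fst p) k) (D k (n - k) (f (n - k))))"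
  using D f subspace_scale[OF realises_simps(5)[OF M]]
  by (simp add: laurent_module_def realises_simps[OF M] realises_finsum[OF M])

text \<open>The support of the image lies in finitely many translates of the support of \<open>f\<close>.\<close>

lemma laurent_act_closed:
  assumes M: "realises M B" and f: "f \<in> carrier (laurent_module M D)"
    and D: "\<And>k j v. v \<in> B \<Longrightarrow> D k j v \<in> B" and D0: "\<And>k j. D k j 0 = 0"
  shows "act (laurent_module M D) p f \<in> carrier (laurent_module M D)"
proof -
  note B = realises_simps(5)[OF M]
  have fin: "finite {n. f n \<noteq> 0}" and "\<forall>n. f n \<in> B"
    using f by (auto simp: laurent_carrier[OF M])
  then have fB: "f n \<in> B" for n
    by blast
  let ?K = "Poly_Mapping.keys (fst p)"
  let ?g = "act (laurent_module M D) p f"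
  have g: "?g n = (\<Sum>k\<in>?K. s (Poly_Mapping.lookup (fst p) k) (D k (n - k) (f (n - k))))" for n
    by (rule laurent_act[OF M]) (use fB D in auto)
  have "{n. ?g n \<noteq> 0} \<subseteq> (\<Union>k\<in>?K. (\<lambda>n. n + k) ` {n. f n \<noteq> 0})"
  proof
    fix n
    assume "n \<in> {n. ?g n \<noteq> 0}"
    then obtain k where k: "k \<in> ?K" "s (Poly_Mapping.lookup (fst p) k) (D k (n - k) (f (n - k))) \<noteq> 0"
      unfolding g mem_Collect_eq by (rule sum.not_neutral_contains_not_neutral)
    then have "f (n - k) \<noteq> 0"
      by (auto simp: D0)
    then show "n \<in> (\<Union>k\<in>?K. (\<lambda>n. n + k) ` {n. f n \<noteq> 0})"
      using k(1) by (intro UN_I[of k] image_eqI[of _ _ "n - k"]) auto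
  qed
  then have "finite {n. ?g n \<noteq> 0}"
    by (rule finite_subset) (intro finite_UN_I finite_keys finite_imageI fin)
  moreover have "?g n \<in> B" for n
    unfolding g by (intro subspace_sum[OF B] subspace_scale[OF B] D fB)
  ultimately show ?thesis
    by (simp add: laurent_carrier[OF M])
qed

lemma laurent_act_zero:
  assumes M: "realises M B" and D: "\<And>k j v. v \<in> B \<Longrightarrow> D k j v \<in> B" and D0: "\<And>k j. D k j 0 = 0"
  shows "act (laurent_module M D) p (zero (laurent_module M D)) = zero (laurent_module M D)"
  using laurent_act[where f = "\<lambda>n. 0", OF M subspace_0[OF realises_simps(5)[OF M]] D]
  by (auto simp: laurent_zero[OF M] D0 fun_eq_iff)

text \<open>The homomorphism principle behind both isomorphisms of the theorem: a map given degree by degree is a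
  homomorphism as soon as its components intertwine the structure operators from degree \<open>j\<close> to
  degree \<open>k + j\<close>.\<close>

lemma laurent_map_hom:
  assumes M: "realises M B" and M': "realises M' B'"
    and D: "\<And>k j v. v \<in> B \<Longrightarrow> D k j v \<in> B" and D': "\<And>k j v. v \<in> B' \<Longrightarrow> D' k j v \<in> B'"
    and T: "\<And>n v. v \<in> B \<Longrightarrow> T n v \<in> B'"
    and T_add: "\<And>n u v. T n (u + v) = T n u + T n v"
    and T_scale: "\<And>n c v. T n (s c v) = s c (T n v)"
    and T_D: "\<And>k j v. v \<in> B \<Longrightarrow> T (k + j) (D k j v) = D' k j (T j v)"
  shows "lie_hom virasoro (laurent_module M D) (laurent_module M' D') (\<lambda>f n. T n (f n))"
  unfolding lie_hom_def
proof (intro conjI ballI allI Pi_I)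
  note B = realises_simps(5)[OF M]
  have T0: "T n 0 = 0" for n
    using T_add[of n 0 0] by simp
  have T_sum: "T n (\<Sum>i\<in>A. g i) = (\<Sum>i\<in>A. T n (g i))" for n and A :: "int set" and g
    by (induction A rule: infinite_finite_induct) (simp_all add: T_add T0)
  {
    fix f
    assume "f \<in> carrier (laurent_module M D)"
    then show "(\<lambda>n. T n (f n)) \<in> carrier (laurent_module M' D')"
      by (auto simp: laurent_carrier[OF M] laurent_carrier[OF M'] T T0 intro: finite_support_map)
  }
  {
    fix f g
    show "(\<lambda>n. T n ((f \<oplus>\<^bsub>laurent_module M D\<^esub> g) n)) =
        (\<lambda>n. T n (f n)) \<oplus>\<^bsub>laurent_module M' D'\<^esub> (\<lambda>n. T n (g n))"
      by (simp add: laurent_add[OF M] laurent_add[OF M'] T_add)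
  }
  {
    fix c f
    show "(\<lambda>n. T n ((c \<odot>\<^bsub>laurent_module M D\<^esub> f) n)) = c \<odot>\<^bsub>laurent_module M' D'\<^esub> (\<lambda>n. T n (f n))"
      by (simp add: laurent_smult[OF M] laurent_smult[OF M'] T_scale)
  }
  {
    fix p :: vir and f
    assume "f \<in> carrier (laurent_module M D)"
    then have f: "f n \<in> B" for n
      by (simp add: laurent_carrier[OF M])
    show "(\<lambda>n. T n (act (laurent_module M D) p f n)) = act (laurent_module M' D') p (\<lambda>n. T n (f n))"
    proof
      fix n
      have TD: "T n (D k (n - k) v) = D' k (n - k) (T (n - k) v)" if "v \<in> B" for k v
        using T_D[OF that, of k "n - k"] by simp
      show "T n (act (laurent_module M D) p f n) = act (laurent_module M' D') p (\<lambda>n. T n (f n)) n"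
        using laurent_act[where p = p and n = n and f = f, OF M f D]
          laurent_act[where p = p and n = n and f = "\<lambda>n. T n (f n)", OF M' T[OF f] D']
        by (simp add: T_sum T_scale TD f)
    qed
  }
qed

end

section \<open>Representations of the Witt algebra and their level filtration\<close>

locale witt_rep = complex_vector_space s
  for s :: "complex \<Rightarrow> 'w::ab_group_add \<Rightarrow> 'w" +
  fixes \<rho> :: "complex poly \<Rightarrow> 'w \<Rightarrow> 'w"
  assumes \<rho>_add: "\<rho> f (u + v) = \<rho> f u + \<rho> f v"
    and \<rho>_scale: "\<rho> f (s c v) = s c (\<rho> f v)"
    and \<rho>_add_left: "\<rho> (f + g) v = \<rho> f v + \<rho> g v"
    and \<rho>_smult_left: "\<rho> (Polynomial.smult c f) v = s c (\<rho> f v)"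
    and \<rho>_bracket: "\<rho> (f * pderiv g - g * pderiv f) v = \<rho> f (\<rho> g v) - \<rho> g (\<rho> f v)"
begin

lemma \<rho>_zero [simp]: "\<rho> f 0 = 0"
  using \<rho>_add[of f 0 0] by simp

lemma \<rho>_minus: "\<rho> f (- v) = - \<rho> f v"
  using \<rho>_add[of f "- v" v] by (simp add: eq_neg_iff_add_eq_0)

lemma \<rho>_diff: "\<rho> f (u - v) = \<rho> f u - \<rho> f v"
  using \<rho>_add[of f u "- v"] by (simp add: \<rho>_minus)

lemma \<rho>_zero_left [simp]: "\<rho> 0 v = 0"
  using \<rho>_add_left[of 0 0 v] by simp

lemma \<rho>_sum: "\<rho> f (\<Sum>i\<in>A. g i) = (\<Sum>i\<in>A. \<rho> f (g i))"
  by (induction A rule: infinite_finite_induct) (simp_all add: \<rho>_add)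

lemma \<rho>_sum_left: "\<rho> (\<Sum>i\<in>A. g i) v = (\<Sum>i\<in>A. \<rho> (g i) v)"
  by (induction A rule: infinite_finite_induct) (simp_all add: \<rho>_add_left)

text \<open>In this numbering \<open>e i\<close> is the action of \<open>d\<^sub>i\<^sub>-\<^sub>1 = t\<^sup>i d/dt\<close>: so \<open>e 0\<close> is \<open>d/dt\<close>, and the
  subalgebra \<open>\<bb>\<close> is spanned by the elements of positive index.\<close>

definition e :: "nat \<Rightarrow> 'w \<Rightarrow> 'w" where
  "e i = \<rho> (monom 1 i)"

lemma e_zero [simp]: "e i 0 = 0"
  and e_add: "e i (u + v) = e i u + e i v"
  and e_diff: "e i (u - v) = e i u - e i v"
  and e_scale: "e i (s c v) = s c (e i v)"
  and e_sum: "e i (\<Sum>k\<in>A. g k) = (\<Sum>k\<in>A. e i (g k))"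
  by (simp_all add: e_def \<rho>_add \<rho>_diff \<rho>_scale \<rho>_sum)

lemma \<rho>_expand: "\<rho> f v = (\<Sum>i\<le>degree f. s (coeff f i) (e i v))"
proof -
  have "\<rho> f v = \<rho> (\<Sum>i\<le>degree f. Polynomial.smult (coeff f i) (monom 1 i)) v"
    by (simp add: smult_monom poly_as_sum_of_monoms)
  then show ?thesis
    by (simp add: \<rho>_sum_left \<rho>_smult_left e_def)
qed

lemma e_commute:
  "e i (e j v) = e j (e i v) + s (of_int (int j - int i)) (e (i + j - 1) v)"
proof -
  have "monom 1 i * pderiv (monom 1 j) - monom 1 j * pderiv (monom (1::complex) i) =
      Polynomial.smult (of_int (int j - int i)) (monom 1 (i + j - 1))"
    by (cases i; cases j)
      (simp_all add: pderiv_monom mult_monom smult_monom diff_monom minus_monom monom_eq_iff'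
        add.commute algebra_simps)
  then have "s (of_int (int j - int i)) (e (i + j - 1) v) = e i (e j v) - e j (e i v)"
    by (metis \<rho>_bracket \<rho>_smult_left e_def)
  then show ?thesis by (simp add: algebra_simps)
qed

text \<open>Commuting past \<open>d/dt\<close> lowers the index by one. Together with the level filtration below, this
  one relation controls the whole structure of the representation.\<close>

lemma e_D: "e i (e 0 v) = e 0 (e i v) - s (of_nat i) (e (i - 1) v)"
  using e_commute[of i 0 v] by (simp add: scale_minus_left)

lemma subspace_\<rho>_closed:
  assumes "subspace H" "\<And>i. coeff f i \<noteq> 0 \<Longrightarrow> e i v \<in> H"
  shows "\<rho> f v \<in> H"
proof -
  have "s (coeff f i) (e i v) \<in> H" for i
  proof (cases "coeff f i = 0")
    case True
    then show ?thesis by (simp add: subspace_0[OF assms(1)])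
  next
    case False
    then show ?thesis by (intro subspace_scale assms)
  qed
  then have "(\<Sum>i\<le>degree f. s (coeff f i) (e i v)) \<in> H"
    by (rule subspace_sum[OF assms(1)])
  then show ?thesis
    by (simp only: \<rho>_expand[of f v])
qed

definition borel_stable :: "'w set \<Rightarrow> bool" where
  "borel_stable H \<longleftrightarrow> subspace H \<and> (\<forall>j\<ge>1. \<forall>v\<in>H. e j v \<in> H)"

lemma borel_stable_subspace: "borel_stable H \<Longrightarrow> subspace H"
  and borel_stable_e: "borel_stable H \<Longrightarrow> v \<in> H \<Longrightarrow> j \<ge> 1 \<Longrightarrow> e j v \<in> H"
  by (auto simp: borel_stable_def)

definition level :: "nat \<Rightarrow> 'w set" where
  "level m = {v. \<forall>i>m. e i v = 0}"

lemma level_mono: "m \<le> n \<Longrightarrow> level m \<subseteq> level n"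
  by (auto simp: level_def)

lemma borel_stable_level: "borel_stable (level m)"
  unfolding borel_stable_def
proof (intro conjI allI impI ballI)
  show "subspace (level m)"
    by (rule subspaceI) (auto simp: level_def e_add e_scale)
  fix j :: nat and v
  assume "1 \<le> j" "v \<in> level m"
  then show "e j v \<in> level m"
    using e_commute[of _ j v] by (auto simp: level_def)
qed

lemma subspace_level: "subspace (level m)"
  by (rule borel_stable_subspace[OF borel_stable_level])

text \<open>The key computation: \<open>d/dt - c\<close> raises the exact level by one, whatever \<open>c\<close> is.\<close>

lemma e_shift_top:
  assumes "v \<in> level m"
  shows "e (Suc m) (e 0 v - s c v) = - s (of_nat (Suc m)) (e m v)"
  using assms by (simp add: level_def e_diff e_scale e_D)

end

section \<open>The structure of nontrivial simple representations\<close>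

locale simple_witt_rep = witt_rep s \<rho>
  for s :: "complex \<Rightarrow> 'w::ab_group_add \<Rightarrow> 'w" and \<rho> +
  assumes locally_finite: "\<exists>m. v \<in> level m"
    and simple: "\<lbrakk>subspace H; \<And>i v. v \<in> H \<Longrightarrow> e i v \<in> H\<rbrakk> \<Longrightarrow> H = {0} \<or> H = UNIV"
    and nontrivial: "\<exists>i v. e i v \<noteq> 0"
begin

lemma no_invariants:
  assumes "\<And>i. e i v = 0"
  shows "v = 0"
proof -
  let ?H = "{v. \<forall>i. e i v = 0}"
  have "subspace ?H"
    by (rule subspaceI) (auto simp: e_add e_scale)
  then have "?H = {0} \<or> ?H = UNIV"
    by (rule simple) simp
  then show ?thesis
    using nontrivial assms by auto
qed

text \<open>A least level \<open>m\<close> with \<open>e m v = 0\<close> could be lowered, or, if \<open>m = 0\<close>, the vector would be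
  invariant.\<close>

lemma exact_level:
  assumes "v \<noteq> 0"
  obtains m where "v \<in> level m" "e m v \<noteq> 0"
proof -
  define m where "m = (LEAST m. v \<in> level m)"
  have m: "v \<in> level m"
    unfolding m_def using locally_finite by (rule LeastI_ex)
  have "e m v \<noteq> 0"
  proof
    assume *: "e m v = 0"
    show False
    proof (cases m)
      case 0
      then have "e i v = 0" for i
        using m * by (cases i) (auto simp: level_def)
      then show False
        using no_invariants assms by blast
    next
      case (Suc k)
      have "e i v = 0" if "i > k" for i
        using that m * Suc by (cases "i = Suc k") (auto simp: level_def)
      then have "v \<in> level k"
        by (simp add: level_def)
      then have "m \<le> k"
        unfolding m_def by (rule Least_le)
      then show False
        using Suc by simp
    qed
  qed
  with m show ?thesis by (rule that)
qed

text \<open>The lowest nonzero step of the filtration, \<open>base\<close>, turns out to be the \<open>\<bb>\<close>-socle; the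
  representation is freely generated from it by \<open>d/dt\<close>.\<close>

definition depth :: nat where
  "depth = (LEAST r. level r \<noteq> {0})"

definition base :: "'w set" where
  "base = level depth"

lemma borel_stable_base: "borel_stable base"
  and subspace_base: "subspace base"
  by (simp_all add: base_def borel_stable_level subspace_level)

lemma nonzero_vector: "\<exists>v::'w. v \<noteq> 0"
  using nontrivial by blast

lemma base_nonzero: "base \<noteq> {0}"
proof -
  obtain v :: 'w where "v \<noteq> 0"
    using nonzero_vector by blast
  then have "\<exists>r. level r \<noteq> {0}"
    using locally_finite[of v] by blast
  then show ?thesis
    unfolding base_def depth_def by (rule LeastI_ex)
qed

lemma depth_le:
  assumes "v \<noteq> 0" "v \<in> level m"
  shows "depth \<le> m"
  unfolding depth_def using assms by (intro Least_le) auto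

text \<open>A nonzero vector has exact level at least \<open>depth\<close>, so its image under \<open>d/dt - c\<close> has exact level
  greater than \<open>depth\<close>. This gives at once the injectivity of \<open>d/dt - c\<close> and the directness of
  \<open>base + (d/dt - c) W\<close>.\<close>

lemma shift_notin_base:
  assumes "e 0 v - s c v \<in> base"
  shows "v = 0"
proof (rule ccontr)
  assume "v \<noteq> 0"
  then obtain m where m: "v \<in> level m" "e m v \<noteq> 0"
    by (rule exact_level)
  then have "depth < Suc m"
    using depth_le[OF \<open>v \<noteq> 0\<close>] by (simp add: less_Suc_eq_le)
  then have "e (Suc m) (e 0 v - s c v) = 0"
    using assms by (simp add: base_def level_def)
  then have "s (of_nat (Suc m)) (e m v) = 0"
    by (simp add: e_shift_top[OF m(1)] del: of_nat_Suc)
  then show False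
    using m(2) by (simp add: scale_eq_0_iff del: of_nat_Suc)
qed

lemma shift_injective:
  assumes "e 0 u - s c u = e 0 v - s c v"
  shows "u = v"
proof -
  have "e 0 (u - v) - s c (u - v) = 0"
    using assms by (simp add: e_diff scale_right_diff_distrib algebra_simps)
  then have "u - v = 0"
    using shift_notin_base[of "u - v" c] subspace_0[OF subspace_base] by simp
  then show ?thesis by simp
qed

text \<open>For a subspace \<open>H\<close> this is the sum of all \<open>(d/dt)\<^sup>n H\<close>, generated without reference to
  scalars: closure under scaling is inherited from \<open>H\<close>.\<close>

inductive_set D_closure :: "'w set \<Rightarrow> 'w set" for H where
  base: "v \<in> H \<Longrightarrow> v \<in> D_closure H"
| add: "u \<in> D_closure H \<Longrightarrow> v \<in> D_closure H \<Longrightarrow> u + v \<in> D_closure H"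
| shift: "v \<in> D_closure H \<Longrightarrow> e 0 v \<in> D_closure H"

text \<open>Moving the operators \<open>e i\<close> past \<open>d/dt\<close> shows that the closure of a \<open>\<bb>\<close>-submodule is a
  submodule, hence everything by simplicity.\<close>

lemma D_closure_eq_UNIV:
  assumes H: "borel_stable H" "H \<noteq> {0}"
  shows "D_closure H = UNIV"
proof -
  have scale: "s c v \<in> D_closure H" if "v \<in> D_closure H" for c v
    using that
  proof induction
    case (base v)
    then show ?case
      using H by (auto simp: borel_stable_def intro: D_closure.base subspace_scale)
  next
    case (add u v)
    then show ?case by (simp add: scale_right_distrib D_closure.add)
  next
    case (shift v)
    then show ?case by (metis e_scale D_closure.shift)
  qed
  have sub: "subspace (D_closure H)"
    using H scale by (intro subspaceI)
      (auto simp: borel_stable_def intro: D_closure.intros subspace_0)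
  \<comment> \<open>The index is generalised since the case of \<open>e 0 v\<close> needs the claim at \<open>i - 1\<close>.\<close>
  have "e i v \<in> D_closure H" if "v \<in> D_closure H" for i v
    using that
  proof (induction arbitrary: i)
    case (base v)
    then show ?case
      using borel_stable_e[OF H(1), of v i]
      by (cases "i = 0") (auto simp: Suc_le_eq intro: D_closure.shift D_closure.base)
  next
    case (add u v)
    then show ?case by (simp add: e_add D_closure.add)
  next
    case (shift v)
    then show ?case
      unfolding e_D[of i] by (intro subspace_diff[OF sub] scale D_closure.shift)
  qed
  then have "D_closure H = {0} \<or> D_closure H = UNIV"
    by (intro simple sub)
  moreover obtain v where "v \<in> H" "v \<noteq> 0"
    using H(2) subspace_0[OF borel_stable_subspace[OF H(1)]] by auto
  ultimately show ?thesis
    by (auto intro: D_closure.base)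
qed

text \<open>Modulo the image of \<open>d/dt - c\<close> the operator \<open>d/dt\<close> is the scalar \<open>c\<close>, so everything generated
  from \<open>H\<close> by \<open>d/dt\<close> is congruent to an element of \<open>H\<close>.\<close>

lemma shift_decomposition:
  assumes H: "borel_stable H" "H \<noteq> {0}"
  obtains b u where "b \<in> H" "w = b + (e 0 u - s c u)"
proof -
  have subH: "subspace H"
    using H by (rule_tac borel_stable_subspace)
  have "w \<in> D_closure H"
    using D_closure_eq_UNIV[OF H] by simp
  then have "\<exists>b\<in>H. \<exists>u. w = b + (e 0 u - s c u)"
  proof induction
    case (base v)
    then show ?case by (intro bexI[of _ v] exI[of _ 0]) auto
  next
    case (add x y)
    then obtain b u b' u' where "b \<in> H" "x = b + (e 0 u - s c u)"
      "b' \<in> H" "y = b' + (e 0 u' - s c u')" by blast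
    then show ?case
      by (intro bexI[of _ "b + b'"] exI[of _ "u + u'"])
        (auto simp: e_add scale_right_distrib subspace_add[OF subH])
  next
    case (shift v)
    then obtain b u where bu: "b \<in> H" "v = b + (e 0 u - s c u)" by blast
    show ?case
    proof (intro bexI exI)
      have "s c v = s c b + (e 0 (s c u) - s c (s c u))"
        by (simp add: bu(2) e_scale scale_right_distrib scale_right_diff_distrib)
      then show "e 0 v = s c b + (e 0 (s c u + v) - s c (s c u + v))"
        by (simp add: e_add scale_right_distrib algebra_simps)
    qed (use bu subH in \<open>auto intro: subspace_scale\<close>)
  qed
  then show ?thesis using that by blast
qed

text \<open>If \<open>depth\<close> were zero, \<open>\<bb>\<close> would annihilate \<open>base\<close>. Then the image of \<open>d/dt\<close> is a submodule, the
  analogue of exact forms; it is nonzero because \<open>W\<close> is nontrivial and proper because it meets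
  \<open>base\<close> only in zero.\<close>

lemma depth_pos: "depth > 0"
proof (rule ccontr)
  assume "\<not> depth > 0"
  then have killed: "e i b = 0" if "b \<in> base" "i > 0" for i b
    using that by (auto simp: base_def level_def)
  have sub: "subspace (range (e 0))"
  proof (rule subspaceI)
    show "0 \<in> range (e 0)"
      using rangeI[of "e 0" 0] by simp
  qed (auto simp flip: e_add e_scale)
  have in_range: "e i w \<in> range (e 0)" for i w
  proof (induction i arbitrary: w)
    case 0
    show ?case by simp
  next
    case (Suc i)
    obtain b u where "b \<in> base" "w = b + (e 0 u - s 0 u)"
      by (rule shift_decomposition[OF borel_stable_base base_nonzero])
    then have "e (Suc i) w = e 0 (e (Suc i) u) - s (of_nat (Suc i)) (e i u)"
      by (simp add: e_add killed e_D)
    then show ?case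
      using Suc by (simp add: subspace_diff[OF sub] subspace_scale[OF sub])
  qed
  then have "range (e 0) = {0} \<or> range (e 0) = UNIV"
    by (intro simple sub)
  then show False
  proof
    assume "range (e 0) = {0}"
    then show False
      using in_range nontrivial by auto
  next
    assume surj: "range (e 0) = UNIV"
    obtain v where v: "v \<in> base" "v \<noteq> 0"
      using base_nonzero subspace_0[OF subspace_base] by auto
    from surj obtain u where "v = e 0 u" by blast
    then have "u = 0"
      using v shift_notin_base[of u 0] by simp
    then show False
      using v \<open>v = e 0 u\<close> by simp
  qed
qed

text \<open>Modulo \<open>base\<close> a vector above the lowest level is \<open>e 0 u\<close> with \<open>u\<close> one level lower, and
  the top operator sends it to a multiple of the top operator applied to \<open>u\<close>. Descending in this way ends in \<open>base\<close>, which
  \<open>e depth\<close> preserves because \<open>depth\<close> is positive.\<close>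

lemma e_top_in_base:
  assumes "v \<in> level m" "depth \<le> m"
  shows "e m v \<in> base"
  using assms(2,1)
proof (induction m arbitrary: v rule: dec_induct)
  case base
  then show ?case
    using depth_pos borel_stable_e[OF borel_stable_base, of v depth] by (simp add: base_def)
next
  case (step m)
  obtain b u where b: "b \<in> base" and v: "v = b + (e 0 u - s 0 u)"
    by (rule shift_decomposition[OF borel_stable_base base_nonzero])
  have "u \<in> level m"
  proof (cases "u = 0")
    case True
    then show ?thesis by (simp add: level_def)
  next
    case False
    then obtain k where k: "u \<in> level k" "e k u \<noteq> 0"
      by (rule exact_level)
    have "k \<le> m"
    proof (rule ccontr)
      assume "\<not> k \<le> m"
      then have "e (Suc k) v = 0" "e (Suc k) b = 0"
        using step b by (auto simp: level_def base_def)
      then have "e (Suc k) (e 0 u - s 0 u) = 0"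
        by (simp add: v e_add)
      then have "s (of_nat (Suc k)) (e k u) = 0"
        by (simp add: e_shift_top[OF k(1)] del: of_nat_Suc scale_zero_left)
      then show False
        using k(2) by (simp add: scale_eq_0_iff del: of_nat_Suc)
    qed
    then show ?thesis
      using k(1) level_mono by blast
  qed
  moreover have "e (Suc m) b = 0"
    using step b by (simp add: level_def base_def)
  ultimately have "e (Suc m) v = - s (of_nat (Suc m)) (e m u)"
    by (simp only: v e_add e_shift_top add_0_left)
  moreover have "e m u \<in> base"
    using step.IH \<open>u \<in> level m\<close> by blast
  ultimately show ?case
    by (simp only: subspace_neg[OF subspace_base] subspace_scale[OF subspace_base])
qed

text \<open>The top operator moves a nonzero vector of \<open>H\<close> to a nonzero vector of \<open>H \<inter> base\<close>, and
  \<open>H \<inter> base\<close> generates everything, so it already exhausts \<open>base\<close>. Hence \<open>base\<close> is the unique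
  minimal \<open>\<bb>\<close>-submodule.\<close>

lemma base_subset:
  assumes H: "borel_stable H" "H \<noteq> {0}"
  shows "base \<subseteq> H"
proof
  fix b
  assume b: "b \<in> base"
  obtain v where v: "v \<in> H" "v \<noteq> 0"
    using H subspace_0[OF borel_stable_subspace[OF H(1)]] by auto
  then obtain m where m: "v \<in> level m" "e m v \<noteq> 0"
    using exact_level by blast
  have "depth \<le> m"
    using depth_le v m by blast
  then have "e m v \<in> H \<inter> base"
    using depth_pos borel_stable_e[OF H(1) v(1)] e_top_in_base m(1) by auto
  then have ne: "H \<inter> base \<noteq> {0}"
    using m(2) by blast
  have st: "borel_stable (H \<inter> base)"
    using H(1) borel_stable_base unfolding borel_stable_def
    by (auto intro: subspace_inter)
  obtain b' u where b': "b' \<in> H \<inter> base" "b = b' + (e 0 u - s 0 u)"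
    by (rule shift_decomposition[OF st ne])
  then have "e 0 u - s 0 u \<in> base"
    using b subspace_diff[OF subspace_base, of b b'] by simp
  then have "u = 0"
    by (rule shift_notin_base)
  then show "b \<in> H"
    using b' by simp
qed

text \<open>The projection onto \<open>base\<close> along the image of \<open>d/dt - c\<close>.\<close>

definition proj :: "complex \<Rightarrow> 'w \<Rightarrow> 'w" where
  "proj c w = (THE b. b \<in> base \<and> (\<exists>u. w = b + (e 0 u - s c u)))"

lemma proj_eqI:
  assumes "b \<in> base" "w = b + (e 0 u - s c u)"
  shows "proj c w = b"
  unfolding proj_def
proof (rule the_equality)
  show "b \<in> base \<and> (\<exists>u. w = b + (e 0 u - s c u))"
    using assms by blast
  fix b'
  assume "b' \<in> base \<and> (\<exists>u. w = b' + (e 0 u - s c u))"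
  then obtain u' where b': "b' \<in> base" "w = b' + (e 0 u' - s c u')" by blast
  have "e 0 (u - u') - s c (u - u') = b' - b"
    using assms b' by (simp add: e_diff scale_right_diff_distrib algebra_simps)
  then have "u - u' = 0"
    using subspace_diff[OF subspace_base b'(1) assms(1)] shift_notin_base[of "u - u'" c] by simp
  then show "b' = b"
    using assms b' by simp
qed

lemma proj_decomposition:
  obtains u where "proj c w \<in> base" "w = proj c w + (e 0 u - s c u)"
proof -
  obtain b u where "b \<in> base" "w = b + (e 0 u - s c u)"
    by (rule shift_decomposition[OF borel_stable_base base_nonzero])
  then show ?thesis
    using that[of u] proj_eqI[of b w u c] by simp
qed

lemma proj_in_base: "proj c w \<in> base"
  by (rule proj_decomposition)

lemma proj_base: "b \<in> base \<Longrightarrow> proj c b = b"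
  by (rule proj_eqI[of _ _ 0]) simp_all

lemma proj_add: "proj c (v + w) = proj c v + proj c w"
proof -
  obtain u where u: "v = proj c v + (e 0 u - s c u)" by (rule proj_decomposition)
  obtain u' where u': "w = proj c w + (e 0 u' - s c u')" by (rule proj_decomposition)
  have "v + w = proj c v + proj c w + (e 0 (u + u') - s c (u + u'))"
    by (subst u, subst u') (simp add: e_add scale_right_distrib)
  then show ?thesis
    by (intro proj_eqI subspace_add[OF subspace_base] proj_in_base)
qed

lemma proj_scale: "proj c (s k v) = s k (proj c v)"
proof -
  obtain u where u: "v = proj c v + (e 0 u - s c u)" by (rule proj_decomposition)
  have "s k v = s k (proj c v) + (e 0 (s k u) - s c (s k u))"
    by (subst u) (simp add: e_scale scale_right_distrib scale_right_diff_distrib mult.commute)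
  then show ?thesis
    by (intro proj_eqI subspace_scale[OF subspace_base] proj_in_base)
qed

lemma proj_eq_0_iff: "proj c w = 0 \<longleftrightarrow> w \<in> range (\<lambda>u. e 0 u - s c u)"
proof
  assume *: "proj c w = 0"
  obtain u where "w = proj c w + (e 0 u - s c u)"
    by (rule proj_decomposition)
  with * show "w \<in> range (\<lambda>u. e 0 u - s c u)"
    by simp
next
  assume "w \<in> range (\<lambda>u. e 0 u - s c u)"
  then obtain u where "w = 0 + (e 0 u - s c u)" by auto
  then show "proj c w = 0"
    using subspace_0[OF subspace_base] by (rule_tac proj_eqI)
qed

end

section \<open>Submodules and the socle\<close>

context witt_rep
begin

abbreviation W :: "(complex poly, 'w) lie_module" where
  "W \<equiv> type_module s \<rho>"

lemma realises_W: "realises W UNIV"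
  by (simp add: realises_def type_module_def)

lemma act_W [simp]: "act W = \<rho>"
  by (simp add: type_module_def)

lemma lie_submodule_witt_iff:
  "lie_submodule witt H W \<longleftrightarrow> subspace H \<and> (\<forall>i. \<forall>v\<in>H. e i v \<in> H)"
  using subspace_\<rho>_closed[of H]
  by (auto simp: lie_submodule_def realises_submodule_iff[OF realises_W] witt_def e_def)

lemma lie_submodule_borel_iff: "lie_submodule borel_subalgebra H W \<longleftrightarrow> borel_stable H"
proof
  assume "lie_submodule borel_subalgebra H W"
  then show "borel_stable H"
    by (auto simp: lie_submodule_def realises_submodule_iff[OF realises_W] borel_stable_def
        borel_subalgebra_def e_def)
next
  assume H: "borel_stable H"
  have "\<rho> f v \<in> H" if "coeff f 0 = 0" "v \<in> H" for f v
  proof (rule subspace_\<rho>_closed[OF borel_stable_subspace[OF H]])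
    fix i
    assume "coeff f i \<noteq> 0"
    then have "i \<ge> 1"
      using that(1) by (cases i) auto
    then show "e i v \<in> H"
      by (rule borel_stable_e[OF H that(2)])
  qed
  then show "lie_submodule borel_subalgebra H W"
    using borel_stable_subspace[OF H]
    by (simp add: lie_submodule_def realises_submodule_iff[OF realises_W] borel_subalgebra_def)
qed

end

context simple_witt_rep
begin

lemma minimal_submodule_borel_iff:
  "minimal_submodule borel_subalgebra H W \<longleftrightarrow> H = base"
proof -
  have "\<zero>\<^bsub>W\<^esub> = 0"
    by (simp add: realises_simps[OF realises_W])
  then show ?thesis
    unfolding minimal_submodule_def lie_submodule_borel_iff
    using base_subset borel_stable_base base_nonzero by (metis subset_antisym)
qed

lemma socle_eq_base: "socle borel_subalgebra W = base"
proof
  show "socle borel_subalgebra W \<subseteq> base"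
    by (auto simp: socle_def minimal_submodule_borel_iff realises_finsum[OF realises_W]
        intro!: subspace_sum[OF subspace_base])
  show "base \<subseteq> socle borel_subalgebra W"
  proof
    fix b
    assume "b \<in> base"
    then show "b \<in> socle borel_subalgebra W"
      by (auto simp: socle_def minimal_submodule_borel_iff realises_finsum[OF realises_W]
          intro!: exI[of _ "{base}"] exI[of _ "\<lambda>_. b"])
  qed
qed

section \<open>The operators of the loop modules\<close>

definition E :: "int \<Rightarrow> 'w \<Rightarrow> 'w" where
  "E k w = exp_act W k w"

lemma E_eq_sum:
  assumes "v \<in> level m"
  shows "E k v = (\<Sum>i<Suc m. s (of_int k ^ i / fact i) (e i v))"
proof -
  have "E k v = finsupp_sum W (\<lambda>i. s (of_int k ^ i / fact i) (e i v))"
    by (simp add: E_def exp_act_def realises_simps[OF realises_W] e_def)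
  also have "\<dots> = (\<Sum>i<Suc m. s (of_int k ^ i / fact i) (e i v))"
    by (rule realises_finsupp_sum[OF realises_W]) (use assms in \<open>auto simp: level_def\<close>)
  finally show ?thesis .
qed

lemma common_level:
  obtains m where "u \<in> level m" "v \<in> level m"
proof -
  obtain m n where "u \<in> level m" "v \<in> level n"
    using locally_finite by metis
  then have "u \<in> level (max m n)" "v \<in> level (max m n)"
    using level_mono[of m "max m n"] level_mono[of n "max m n"] by auto
  then show ?thesis by (rule that)
qed

lemma E_add: "E k (u + v) = E k u + E k v"
proof -
  obtain m where m: "u \<in> level m" "v \<in> level m" by (rule common_level)
  then have "u + v \<in> level m"
    by (rule subspace_add[OF subspace_level])
  with m show ?thesis
    by (simp only: E_eq_sum e_add scale_right_distrib sum.distrib)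
qed

lemma E_scale: "E k (s c v) = s c (E k v)"
proof -
  obtain m where m: "v \<in> level m"
    using locally_finite by blast
  then have "s c v \<in> level m"
    by (rule subspace_scale[OF subspace_level])
  with m show ?thesis
    by (simp only: E_eq_sum e_scale scale_sum_right scale_left_commute)
qed

lemma E_zero [simp]: "E k 0 = 0"
  using E_scale[of k 0 0] by simp

lemma E_diff: "E k (u - v) = E k u - E k v"
  using E_add[of k "u - v" v] by (simp add: algebra_simps)

lemma e_0_level:
  assumes "v \<in> level m"
  shows "e 0 v \<in> level (Suc m)"
  using assms by (auto simp: level_def e_D)

text \<open>The vector field identity \<open>[d/dt, e\<^sup>k\<^sup>t d/dt] = k e\<^sup>k\<^sup>t d/dt\<close>.\<close>

lemma E_D: "E k (e 0 v) = e 0 (E k v) - s (of_int k) (E k v)"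
proof -
  obtain m where m: "v \<in> level m"
    using locally_finite by blast
  define c :: "nat \<Rightarrow> complex" where "c i = of_int k ^ i / fact i" for i
  have c_Suc: "c (Suc i) * of_nat (Suc i) = of_int k * c i" for i
    by (simp add: c_def field_simps del: of_nat_Suc)
  have m': "v \<in> level (Suc m)"
    using m level_mono[of m "Suc m"] by auto
  have "E k (e 0 v) = (\<Sum>i<Suc (Suc m). s (c i) (e 0 (e i v)) - s (c i * of_nat i) (e (i - 1) v))"
    by (simp only: E_eq_sum[OF e_0_level[OF m]] e_D[of _ v] scale_right_diff_distrib scale_scale c_def)
  also have "\<dots> = e 0 (\<Sum>i<Suc (Suc m). s (c i) (e i v))
      - (\<Sum>i<Suc (Suc m). s (c i * of_nat i) (e (i - 1) v))"
    by (simp only: sum_subtractf e_sum e_scale)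
  also have "(\<Sum>i<Suc (Suc m). s (c i * of_nat i) (e (i - 1) v)) =
      (\<Sum>i<Suc m. s (of_int k * c i) (e i v))"
    by (subst sum.lessThan_Suc_shift) (simp add: c_Suc del: of_nat_Suc sum.lessThan_Suc)
  also have "\<dots> = s (of_int k) (E k v)"
    by (simp only: E_eq_sum[OF m] scale_sum_right scale_scale c_def)
  finally show ?thesis
    by (simp only: E_eq_sum[OF m'] c_def)
qed

definition L_op :: "complex \<Rightarrow> complex \<Rightarrow> complex \<Rightarrow> int \<Rightarrow> int \<Rightarrow> 'w \<Rightarrow> 'w" where
  "L_op l a b k j w = s (l powi k) (E k w) - e 0 w + s (a + of_int k * b + of_int j) w"

definition \<theta> :: "complex \<Rightarrow> 'w \<Rightarrow> 'w" where
  "\<theta> c w = e 0 w - s c w"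

lemma L_module_eq: "L_module W l a b = laurent_module W (L_op l a b)"
proof -
  have "u \<ominus>\<^bsub>W\<^esub> v = u - v" for u v
    by (rule realises_minus[OF realises_W]) simp_all
  then show ?thesis
    by (simp add: L_module_def L_op_def[abs_def] E_def[symmetric] e_def[symmetric]
        realises_simps[OF realises_W] del: monom_eq_1)
qed

lemma L_op_zero [simp]: "L_op l a b k j 0 = 0"
  by (simp add: L_op_def)

lemma L_op_add: "L_op l a b k j (u + v) = L_op l a b k j u + L_op l a b k j v"
  by (simp add: L_op_def E_add e_add scale_right_distrib)

lemma \<theta>_add: "\<theta> c (u + v) = \<theta> c u + \<theta> c v"
  by (simp add: \<theta>_def e_add scale_right_distrib)

lemma \<theta>_scale: "\<theta> c (s k v) = s k (\<theta> c v)"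
  by (simp add: \<theta>_def e_scale scale_right_diff_distrib mult.commute)

text \<open>The heart of the first isomorphism: applying \<open>d/dt - a - n\<close> in degree \<open>n\<close> turns the parameter
  \<open>b = 0\<close> into \<open>b = 1\<close>, because moving \<open>d/dt\<close> past \<open>e\<^sup>k\<^sup>t d/dt\<close> costs exactly the factor \<open>k\<close> by which
  the degree changes.\<close>

lemma \<theta>_L_op: "\<theta> (a + of_int (k + j)) (L_op l a 0 k j w) = L_op l a 1 k j (\<theta> (a + of_int j) w)"
  unfolding \<theta>_def L_op_def
  by (simp add: E_D E_add E_diff E_scale e_diff e_add e_scale scale_left_distrib scale_right_distrib
      scale_left_diff_distrib scale_right_diff_distrib distrib_left distrib_right
      mult.commute mult.left_commute add.assoc)

abbreviation N_base :: "(complex poly, 'w) lie_module" where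
  "N_base \<equiv> twist (W\<lparr>carrier := base\<rparr>) 1"

definition N_op :: "complex \<Rightarrow> int \<Rightarrow> int \<Rightarrow> 'w \<Rightarrow> 'w" where
  "N_op a m n v = (a + of_int n) \<odot>\<^bsub>N_base\<^esub> v \<oplus>\<^bsub>N_base\<^esub>
     finsupp_sum N_base (\<lambda>i. (of_int m ^ (i + 1) / fact (i + 1)) \<odot>\<^bsub>N_base\<^esub> act N_base (monom 1 (i + 1)) v)"

lemma N_module_eq: "N_module N_base a = laurent_module N_base (N_op a)"
  by (simp add: N_module_def N_op_def[abs_def])

lemma realises_N_base: "realises N_base base"
  by (simp add: realises_def twist_def type_module_def subspace_base)

lemma E_base:
  assumes "v \<in> base"
  shows "E k v = e 0 v + (\<Sum>i<depth. s (of_int k ^ (i + 1) / fact (i + 1)) (e (i + 1) v))"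
  using assms unfolding base_def
  by (simp add: E_eq_sum sum.lessThan_Suc_shift del: sum.lessThan_Suc)

lemma E_minus_D_in_base:
  assumes "v \<in> base"
  shows "E k v - e 0 v \<in> base"
  using borel_stable_e[OF borel_stable_base assms]
  by (simp add: E_base[OF assms] subspace_sum[OF subspace_base] subspace_scale[OF subspace_base])

text \<open>On \<open>base\<close> the series defining the action is \<open>e\<^sup>m\<^sup>t d/dt - d/dt\<close>, and the twist by one adds the scalar
  \<open>m\<close>, which completes \<open>a + n\<close> to the target degree \<open>a + m + n\<close>.\<close>

lemma N_op_eq:
  assumes v: "v \<in> base"
  shows "N_op a m n v = s (a + of_int (m + n)) v + (E m v - e 0 v)"
proof -
  let ?g = "\<lambda>i. s (of_int m ^ (i + 1) / fact (i + 1)) (e (i + 1) v)"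
  \<comment> \<open>\<open>?h\<close> is the contribution of the twist, which only affects \<open>d\<^sub>0\<close>.\<close>
  let ?h = "\<lambda>i. if i = 0 then s (of_int m) v else 0"
  have "finsupp_sum N_base (\<lambda>i. ?g i + ?h i) = (\<Sum>i<depth. ?g i + ?h i)"
  proof (rule realises_finsupp_sum[OF realises_N_base])
    show "?g i + ?h i \<in> base" for i
      using borel_stable_e[OF borel_stable_base v, of "i + 1"] v
      by (auto intro!: subspace_add[OF subspace_base] subspace_scale[OF subspace_base]
          subspace_0[OF subspace_base])
    show "?g i + ?h i = 0" if "i \<ge> depth" for i
      using that v depth_pos by (auto simp: base_def level_def)
  qed
  also have "\<dots> = (E m v - e 0 v) + s (of_int m) v"
    using depth_pos by (simp add: E_base[OF v] sum.distrib)
  finally have *: "finsupp_sum N_base (\<lambda>i. ?g i + ?h i) = (E m v - e 0 v) + s (of_int m) v" .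
  have "act N_base (monom 1 (i + 1)) v = e (i + 1) v + (if i = 0 then v else 0)" for i
    by (simp add: twist_def realises_simps[OF realises_W] e_def)
  then have "(of_int m ^ (i + 1) / fact (i + 1)) \<odot>\<^bsub>N_base\<^esub> act N_base (monom 1 (i + 1)) v = ?g i + ?h i" for i
    by (simp add: realises_simps[OF realises_N_base] scale_right_distrib)
  then show ?thesis
    unfolding N_op_def by (simp only: *) (simp add: realises_simps[OF realises_N_base]
        scale_left_distrib algebra_simps)
qed

lemma N_op_closed: "v \<in> base \<Longrightarrow> N_op a m n v \<in> base"
  by (simp only: N_op_eq E_minus_D_in_base subspace_add[OF subspace_base] subspace_scale[OF subspace_base])

lemma N_op_zero [simp]: "N_op a m n 0 = 0"
  using subspace_0[OF subspace_base] by (simp add: N_op_eq)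

lemma N_op_scale:
  assumes "v \<in> base"
  shows "N_op a m n (s c v) = s c (N_op a m n v)"
  using assms subspace_scale[OF subspace_base assms, of c]
  by (simp add: N_op_eq E_scale e_scale scale_right_distrib scale_right_diff_distrib mult.commute)

lemma proj_plus_\<theta>:
  assumes "b \<in> base"
  shows "proj c (b + \<theta> c u) = b"
  using assms by (intro proj_eqI) (simp_all add: \<theta>_def)

text \<open>In the target degree \<open>d/dt\<close> acts on the quotient as \<open>a + k + j\<close>. Hence the terms
  \<open>- d/dt + a + k + j\<close> vanish there, and what remains is \<open>l\<^sup>k e\<^sup>k\<^sup>t d/dt\<close>, that is, \<open>l\<^sup>k\<close> times
  \<open>(a + k + j) + (e\<^sup>k\<^sup>t d/dt - d/dt)\<close>.\<close>

lemma proj_L_op: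
  "proj (a + of_int (k + j)) (L_op l a 1 k j w) = s (l powi k) (N_op a k j (proj (a + of_int j) w))"
proof -
  obtain u where u: "w = proj (a + of_int j) w + \<theta> (a + of_int j) u"
    unfolding \<theta>_def by (rule proj_decomposition)
  define p where "p = proj (a + of_int j) w"
  have p: "p \<in> base"
    unfolding p_def by (rule proj_in_base)
  let ?\<theta> = "\<theta> (a + of_int (k + j))"
  \<comment> \<open>Replacing \<open>D\<close> by \<open>a + k + j\<close> in \<open>l\<^sup>k D p\<close> and in \<open>- D p\<close> costs \<open>\<theta>\<close> of \<open>l\<^sup>k p\<close> and of \<open>- p\<close>.\<close>
  have "L_op l a 1 k j p = s (l powi k) (N_op a k j p) + ?\<theta> (s (l powi k) p - p)"
    by (simp add: L_op_def N_op_eq[OF p] \<theta>_def e_diff e_scale scale_left_distrib scale_right_distrib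
        scale_right_diff_distrib algebra_simps)
  moreover have "L_op l a 1 k j w = L_op l a 1 k j p + ?\<theta> (L_op l a 0 k j u)"
    using u by (metis L_op_add \<theta>_L_op p_def)
  ultimately have "L_op l a 1 k j w =
      s (l powi k) (N_op a k j p) + ?\<theta> ((s (l powi k) p - p) + L_op l a 0 k j u)"
    by (simp add: \<theta>_add)
  then show ?thesis
    unfolding p_def[symmetric]
    using proj_plus_\<theta> subspace_scale[OF subspace_base] N_op_closed[OF p] by metis
qed

section \<open>The submodule, its isomorphism type and the quotient\<close>

lemma L_prime_eq:
  "L_prime W l a = {f \<in> carrier (L_module W l a 1). \<forall>n. f n \<in> range (\<theta> (a + of_int n))}"
proof -
  have "u \<ominus>\<^bsub>W\<^esub> v = u - v" for u v
    by (rule realises_minus[OF realises_W]) simp_all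
  then show ?thesis
    by (simp add: L_prime_def \<theta>_def[abs_def] e_def[symmetric] realises_simps[OF realises_W]
        del: monom_eq_1)
qed

lemma \<theta>_injective: "\<theta> c u = \<theta> c v \<Longrightarrow> u = v"
  unfolding \<theta>_def by (rule shift_injective)

lemma L_prime_iso:
  "lie_iso virasoro ((L_module W l a 1)\<lparr>carrier := L_prime W l a\<rparr>) (L_module W l a 0)"
proof (rule lie_iso_inverse)
  let ?\<Theta> = "\<lambda>f n. \<theta> (a + of_int n) (f n)"
  let ?L0 = "L_module W l a 0" and ?L1 = "L_module W l a 1"
  note laurent = laurent_carrier[OF realises_W]
  have hom: "lie_hom virasoro ?L0 ?L1 ?\<Theta>"
    unfolding L_module_eq
    by (rule laurent_map_hom[OF realises_W realises_W]) (simp_all only: UNIV_I \<theta>_add \<theta>_scale \<theta>_L_op)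
  have image: "?\<Theta> ` carrier ?L0 = L_prime W l a"
  proof
    show "?\<Theta> ` carrier ?L0 \<subseteq> L_prime W l a"
      using lie_homD(1)[OF hom] by (auto simp: L_prime_eq)
    show "L_prime W l a \<subseteq> ?\<Theta> ` carrier ?L0"
    proof
      fix f
      assume f: "f \<in> L_prime W l a"
      then have "\<forall>n. \<exists>u. f n = \<theta> (a + of_int n) u"
        by (auto simp: L_prime_eq)
      then obtain g where g: "\<And>n. f n = \<theta> (a + of_int n) (g n)"
        by metis
      have "finite {n. f n \<noteq> 0}"
        using f by (simp add: L_prime_eq L_module_eq laurent)
      moreover have "{n. g n \<noteq> 0} \<subseteq> {n. f n \<noteq> 0}"
        using g \<theta>_injective[of _ _ 0] by (auto simp: \<theta>_def)
      ultimately have "g \<in> carrier ?L0"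
        by (auto simp: L_module_eq laurent intro: finite_subset)
      then show "f \<in> ?\<Theta> ` carrier ?L0"
        using g by (intro image_eqI[of _ _ g]) auto
    qed
  qed
  show "lie_hom virasoro ?L0 (?L1\<lparr>carrier := L_prime W l a\<rparr>) ?\<Theta>"
    using hom image unfolding lie_hom_def by auto
  show "bij_betw ?\<Theta> (carrier ?L0) (carrier (?L1\<lparr>carrier := L_prime W l a\<rparr>))"
  proof (rule bij_betw_imageI)
    show "inj_on ?\<Theta> (carrier ?L0)"
      by (rule inj_onI, rule ext) (metis \<theta>_injective)
  qed (simp add: image)
next
  interpret module complex_field "L_module W l a 0"
    unfolding L_module_eq by (rule laurent_module_module[OF realises_W])
  show "u \<oplus>\<^bsub>L_module W l a 0\<^esub> v \<in> carrier (L_module W l a 0)"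
    if "u \<in> carrier (L_module W l a 0)" "v \<in> carrier (L_module W l a 0)" for u v
    using that by simp
  show "c \<odot>\<^bsub>L_module W l a 0\<^esub> v \<in> carrier (L_module W l a 0)"
    if "v \<in> carrier (L_module W l a 0)" for c v
    using that by simp
  show "act (L_module W l a 0) x v \<in> carrier (L_module W l a 0)"
    if "v \<in> carrier (L_module W l a 0)" for x v
    using that unfolding L_module_eq by (rule laurent_act_closed[OF realises_W]) simp_all
qed

text \<open>Rescaling degree \<open>n\<close> by \<open>l\<^sup>-\<^sup>n\<close> absorbs the factor \<open>l\<^sup>k\<close> of \<open>proj_L_op\<close>, so projecting onto \<open>base\<close> in each
  degree becomes a homomorphism; its kernel is \<^const>\<open>L_prime\<close>.\<close>

lemma L_quotient_epimorphism:
  fixes l a :: complex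
  assumes l: "l \<noteq> 0"
  defines "\<Psi> \<equiv> \<lambda>f n. s (l powi (- n)) (proj (a + of_int n) (f n))"
  shows "lie_epimorphism virasoro (L_module W l a 1) (N_module N_base a) \<Psi>"
    and "lie_epimorphism.ker (L_module W l a 1) (N_module N_base a) \<Psi> = L_prime W l a"
proof -
  let ?L = "L_module W l a 1" and ?N = "N_module N_base a"
  let ?T = "\<lambda>n v. s (l powi (- n)) (proj (a + of_int n) v)"
  note carriers = laurent_carrier[OF realises_W] laurent_carrier[OF realises_N_base]
  have T_base: "?T n v \<in> base" for n v
    by (intro subspace_scale[OF subspace_base] proj_in_base)
  have T_L_op: "?T (k + j) (L_op l a 1 k j v) = N_op a k j (?T j v)" for k j v
  proof -
    have "l powi (- (k + j)) * l powi k = l powi (- j)"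
      using l by (simp add: power_int_add[symmetric])
    then show ?thesis
      by (simp only: proj_L_op N_op_scale proj_in_base scale_scale)
  qed
  have hom: "lie_hom virasoro ?L ?N \<Psi>"
    unfolding L_module_eq N_module_eq \<Psi>_def
  proof (rule laurent_map_hom[OF realises_W realises_N_base])
    show "?T n (u + v) = ?T n u + ?T n v" for n u v
      by (simp add: proj_add scale_right_distrib)
    show "?T n (s c v) = s c (?T n v)" for n c v
      by (simp add: proj_scale mult.commute)
  qed (simp_all only: UNIV_I T_base T_L_op N_op_closed)
  have "\<Psi> ` carrier ?L = carrier ?N"
  proof
    show "\<Psi> ` carrier ?L \<subseteq> carrier ?N"
      using lie_homD(1)[OF hom] by blast
    show "carrier ?N \<subseteq> \<Psi> ` carrier ?L"
    proof
      fix g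
      assume "g \<in> carrier ?N"
      then have g: "\<And>n. g n \<in> base" "finite {n. g n \<noteq> 0}"
        by (auto simp: N_module_eq carriers)
      define f where "f n = s (l powi n) (g n)" for n
      have "f \<in> carrier ?L"
        using finite_support_map[OF g(2), of "\<lambda>n. s (l powi n)"]
        by (simp add: L_module_eq carriers f_def)
      moreover have "proj c (f n) = f n" for c n
        unfolding f_def by (intro proj_base subspace_scale[OF subspace_base] g)
      then have "\<Psi> f = g"
        using l by (auto simp: \<Psi>_def f_def power_int_add[symmetric])
      ultimately show "g \<in> \<Psi> ` carrier ?L"
        by blast
    qed
  qed
  moreover have "act ?L x f \<in> carrier ?L" if "f \<in> carrier ?L" for x f
    using that unfolding L_module_eq by (rule laurent_act_closed[OF realises_W]) simp_all
  moreover have "act ?N x \<zero>\<^bsub>?N\<^esub> = \<zero>\<^bsub>?N\<^esub>" for x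
    unfolding N_module_eq by (rule laurent_act_zero[OF realises_N_base]) (simp_all add: N_op_closed)
  moreover have "module complex_field ?L" "module complex_field ?N"
    unfolding L_module_eq N_module_eq
    by (rule laurent_module_module[OF realises_W], rule laurent_module_module[OF realises_N_base])
  ultimately show epi: "lie_epimorphism virasoro ?L ?N \<Psi>"
    using hom by (intro lie_epimorphism.intro lie_epimorphism_axioms.intro)
  have "\<Psi> f = \<zero>\<^bsub>?N\<^esub> \<longleftrightarrow> (\<forall>n. f n \<in> range (\<theta> (a + of_int n)))" for f
    using l by (simp add: \<Psi>_def N_module_eq laurent_zero[OF realises_N_base] fun_eq_iff
        proj_eq_0_iff \<theta>_def[abs_def])
  then show "lie_epimorphism.ker ?L ?N \<Psi> = L_prime W l a"
    by (simp add: lie_epimorphism.ker_def[OF epi] L_prime_eq)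
qed

end

section \<open>The theorem\<close>

theorem lemma8:
  fixes s :: "complex \<Rightarrow> 'w::ab_group_add \<Rightarrow> 'w"
    and \<rho> :: "complex poly \<Rightarrow> 'w \<Rightarrow> 'w"
    and W :: "(complex poly, 'w) lie_module"
    and l a :: complex
  assumes "W = type_module s \<rho>"
    and "in_category_O W"
    and "simple_lie_module witt W"
    and "\<not> trivial_lie_module witt W"
    and "l \<noteq> 0"
  shows "lie_submodule virasoro (L_prime W l a) (L_module W l a 1) \<and>
    lie_iso virasoro ((L_module W l a 1)\<lparr>carrier := L_prime W l a\<rparr>) (L_module W l a 0) \<and>
    lie_iso virasoro (lie_quotient (L_module W l a 1) (L_prime W l a))
      (N_module (twist (W\<lparr>carrier := socle borel_subalgebra W\<rparr>) 1) a)"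
proof -
  have W: "lie_module witt W"
    using assms(2) by (simp add: in_category_O_def)
  then interpret M: module complex_field W
    by (simp add: lie_module_def)
  have sel: "carrier W = UNIV" "add W = (+)" "zero W = 0" "smult W = s" "act W = \<rho>"
    by (simp_all add: assms(1) type_module_def)
  have minus: "u \<ominus>\<^bsub>W\<^esub> v = u - v" for u v
    using M.minus_equality[of "- v" v] by (simp add: a_minus_def sel)
  interpret witt_rep s \<rho>
  proof unfold_locales
    fix c d :: complex and u v
    show "s c (u + v) = s c u + s c v"
      using M.smult_r_distr[of c u v] by (simp add: sel)
    show "s (c + d) u = s c u + s d u"
      using M.smult_l_distr[of c d u] by (simp add: sel) (simp add: complex_field_def)
    show "s c (s d u) = s (c * d) u"
      using M.smult_assoc1[of c d u] by (simp add: sel) (simp add: complex_field_def)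
    show "s 1 u = u"
      using M.smult_one[of u] by (simp add: sel) (simp add: complex_field_def)
  next
    fix f g u v c
    show "\<rho> f (u + v) = \<rho> f u + \<rho> f v" "\<rho> f (s c v) = s c (\<rho> f v)"
      "\<rho> (f + g) v = \<rho> f v + \<rho> g v" "\<rho> (Polynomial.smult c f) v = s c (\<rho> f v)"
      "\<rho> (f * pderiv g - g * pderiv f) v = \<rho> f (\<rho> g v) - \<rho> g (\<rho> f v)"
      using W by (simp_all add: lie_module_def sel minus witt_def)
  qed
  interpret simple_witt_rep s \<rho>
  proof unfold_locales
    fix v
    obtain n where n: "\<And>i. i \<ge> n \<Longrightarrow> e (i + 1) v = 0"
      using assms(2) by (auto simp: in_category_O_def sel e_def)
    have "e i v = 0" if "i > n" for i
      using n[of "i - 1"] that by simp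
    then show "\<exists>m. v \<in> level m"
      by (auto simp: level_def)
  next
    fix H
    assume "subspace H" "\<And>i v. v \<in> H \<Longrightarrow> e i v \<in> H"
    then have "lie_submodule witt H W"
      by (simp add: assms(1) lie_submodule_witt_iff)
    then show "H = {0} \<or> H = UNIV"
      using assms(3) by (simp add: simple_lie_module_def sel)
  next
    obtain f v where "\<rho> f v \<noteq> 0"
      using assms(4) by (auto simp: trivial_lie_module_def sel)
    show "\<exists>i v. e i v \<noteq> 0"
    proof (rule ccontr)
      assume "\<nexists>i v. e i v \<noteq> 0"
      then have "\<rho> f v = 0"
        by (simp add: \<rho>_expand[of f v])
      with \<open>\<rho> f v \<noteq> 0\<close> show False
        by contradiction
    qed
  qed
  note epi = L_quotient_epimorphism[OF assms(5), of a]
  show ?thesis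
    using lie_epimorphism.lie_submodule_ker[OF epi(1)] L_prime_iso[of l a]
      lie_epimorphism.first_isomorphism[OF epi(1)]
    unfolding assms(1) epi(2) socle_eq_base by blast
qed

end
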